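(* There are absolute constants $\epsilon>0$ and $c>0$ such that for every integer $k\ge 2$, the class $\mathcal{I}_k$ of unions of $k$ intervals over $\mathbb{R}$ satisfies $$m^{\mathrm{test}}_\epsilon(\mathcal{I}_k)\ge c\cdot\frac{k}{\log k}\qquad\text{and}\qquad q^{\mathrm{test}}_{0,\epsilon}(\mathcal{I}_k)\ge c\cdot\frac{k}{\log k}.$$
   Context: $f:\mathbb{R}\to\{0,1\}$ is a union of $k$ intervals if there are $k$ intervals $[a_1,b_1],\dots,[a_k,b_k]$ (where $a_i=-\infty$ and $b_i=\infty$ are allowed) such that $f(x)=1$ iff $x$ lies in some $[a_i,b_i]$; $\mathcal{I}_k$ is the class of such functions. For a class $\mathcal{H}$ of functions $\mathcal{X}\to\{0,1\}$ and a probability distribution $\mathcal{D}$ on $\mathcal{X}$, $\mathrm{dist}_{\mathcal{D}}(f,g)=\Pr_{x\sim\mathcal{D}}[f(x)\ne g(x)]$ and $\mathrm{dist}_{\mathcal{D}}(f,\mathcal{H})=\inf_{h\in\mathcal{H}}\mathrm{dist}_{\mathcal{D}}(f,h)$. All testers are computationally unbounded randomized algorithms that must work for every unknown distribution $\mathcal{D}$ (all finitely supported distributions are allowed) and every unknown $f:\mathcal{X}\to\{0,1\}$. (i) $m^{\mathrm{test}}_\epsilon(\mathcal{H})$ is the minimum $m$ such that some algorithm receiving $m$ labelled examples $(x,f(x))$, $x\sim\mathcal{D}$ independently, accepts with probability $\ge 2/3$ if $f\in\mathcal{H}$ and rejects with probability $\ge2/3$ if $\mathrm{dist}_{\mathcal{D}}(f,\mathcal{H})\ge\epsilon$.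 (ii) $q^{\mathrm{test}}_{0,\epsilon}(\mathcal{H})$ is the minimum $q$ such that some algorithm making in total at most $q$ adaptive queries to $f$ at arbitrary points of $\mathcal{X}$ and independent labelled samples $(x,f(x))$, $x\sim\mathcal{D}$, accepts with probability $\ge2/3$ if $\mathrm{dist}_{\mathcal{D}}(f,\mathcal{H})=0$ and rejects with probability $\ge2/3$ if $\mathrm{dist}_{\mathcal{D}}(f,\mathcal{H})\ge\epsilon$. *)

theory Defs
  imports "HOL-Probability.Probability"
begin

text \<open>
  Functions into \<open>{0,1}\<close> are rendered as predicates, with \<open>True\<close> for \<open>1\<close>.
  The endpoints are extended reals; no order between \<open>a i\<close> and \<open>b i\<close> is imposed. Requiring
  \<open>a i \<le> b i\<close> gives the same class, since \<open>[-\<infinity>,-\<infinity>]\<close> contains no real number.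
\<close>

definition interval_unions :: "nat \<Rightarrow> (real \<Rightarrow> bool) set" where
  "interval_unions k =
     {f. \<exists>a b :: nat \<Rightarrow> ereal. \<forall>x. f x \<longleftrightarrow> (\<exists>i<k. a i \<le> ereal x \<and> ereal x \<le> b i)}"

definition fun_dist :: "'a measure \<Rightarrow> ('a \<Rightarrow> bool) \<Rightarrow> ('a \<Rightarrow> bool) \<Rightarrow> real" where
  "fun_dist D f g = measure D {x \<in> space D. f x \<noteq> g x}"

definition class_dist :: "'a measure \<Rightarrow> ('a \<Rightarrow> bool) \<Rightarrow> ('a \<Rightarrow> bool) set \<Rightarrow> real" where
  "class_dist D f H = (INF h\<in>H. fun_dist D f h)"

text \<open>
  The unknown pairs \<open>(D, f)\<close>: an arbitrary Borel probability distribution (in particular any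
  finitely supported one) and a measurable function, so that the probabilities below make sense.
\<close>

definition instance_pair :: "'a::topological_space measure \<Rightarrow> ('a \<Rightarrow> bool) \<Rightarrow> bool" where
  "instance_pair D f \<longleftrightarrow>
     prob_space D \<and> sets D = sets borel \<and> f \<in> borel \<rightarrow>\<^sub>M count_space UNIV"

text \<open>
  A randomized algorithm is a family of deterministic algorithms indexed by a random seed, which
  is drawn from an arbitrary probability space \<open>R\<close> on the reals, independently of the samples.
  The probability space of a run is the product of \<open>R\<close> with the space of independent samples.
  No separate measurability condition on algorithms is needed: \<open>measure\<close> is \<open>0\<close> on
  non-measurable sets, so an event of probability at least \<open>2/3\<close> is measurable.
\<close>

definition run_space :: "real measure \<Rightarrow> 'a measure \<Rightarrow> nat \<Rightarrow> (real \<times> (nat \<Rightarrow> 'a)) measure" where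
  "run_space R D n = R \<Otimes>\<^sub>M Pi\<^sub>M {..<n} (\<lambda>_. D)"

definition labelled :: "('a \<Rightarrow> bool) \<Rightarrow> nat \<Rightarrow> (nat \<Rightarrow> 'a) \<Rightarrow> ('a \<times> bool) list" where
  "labelled f m xs = map (\<lambda>i. (xs i, f (xs i))) [0..<m]"

definition sample_tester ::
  "real \<Rightarrow> ('a::topological_space \<Rightarrow> bool) set \<Rightarrow> nat \<Rightarrow>
   real measure \<Rightarrow> (real \<Rightarrow> ('a \<times> bool) list \<Rightarrow> bool) \<Rightarrow> bool" where
  "sample_tester \<epsilon> H m R T \<longleftrightarrow>
     prob_space R \<and>
     (\<forall>D f. instance_pair D f \<longrightarrow>
        (f \<in> H \<longrightarrow>
           measure (run_space R D m)
             {(\<omega>, xs) \<in> space (run_space R D m). T \<omega> (labelled f m xs)} \<ge> 2/3) \<and>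
        (class_dist D f H \<ge> \<epsilon> \<longrightarrow>
           measure (run_space R D m)
             {(\<omega>, xs) \<in> space (run_space R D m). \<not> T \<omega> (labelled f m xs)} \<ge> 2/3))"

text \<open>The infimum in \<^typ>\<open>enat\<close> is a minimum, or \<open>\<infinity>\<close> if there is no tester at all.\<close>

definition m_test :: "real \<Rightarrow> ('a::topological_space \<Rightarrow> bool) set \<Rightarrow> enat" where
  "m_test \<epsilon> H = Inf {enat m | m. \<exists>R T. sample_tester \<epsilon> H m R T}"

text \<open>
  Deterministic adaptive algorithms: a node either halts (\<open>True\<close> means accept), or queries \<open>f\<close> at
  a point of its choice, or draws a fresh labelled sample; what it does next depends on the answer.
\<close>

datatype 'a alg =
    Halt bool
  | Query 'a "bool \<Rightarrow> 'a alg"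
  | Sample "'a \<Rightarrow> bool \<Rightarrow> 'a alg"

primrec cost_at_most :: "'a alg \<Rightarrow> nat \<Rightarrow> bool" where
  "cost_at_most (Halt b) q \<longleftrightarrow> True"
| "cost_at_most (Query x t) q \<longleftrightarrow> q > 0 \<and> (\<forall>y. cost_at_most (t y) (q - 1))"
| "cost_at_most (Sample t) q \<longleftrightarrow> q > 0 \<and> (\<forall>x y. cost_at_most (t x y) (q - 1))"

text \<open>
  In \<open>run f xs t i\<close> the index \<open>i\<close> counts the samples drawn so far, and \<open>xs i\<close> is the next one.
\<close>

primrec run :: "('a \<Rightarrow> bool) \<Rightarrow> (nat \<Rightarrow> 'a) \<Rightarrow> 'a alg \<Rightarrow> nat \<Rightarrow> bool" where
  "run f xs (Halt b) i = b"
| "run f xs (Query x t) i = run f xs (t (f x)) i"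
| "run f xs (Sample t) i = run f xs (t (xs i) (f (xs i))) (Suc i)"

definition query_tester ::
  "real \<Rightarrow> ('a::topological_space \<Rightarrow> bool) set \<Rightarrow> nat \<Rightarrow>
   real measure \<Rightarrow> (real \<Rightarrow> 'a alg) \<Rightarrow> bool" where
  "query_tester \<epsilon> H q R A \<longleftrightarrow>
     prob_space R \<and>
     (\<forall>\<omega>. cost_at_most (A \<omega>) q) \<and>
     (\<forall>D f. instance_pair D f \<longrightarrow>
        (class_dist D f H = 0 \<longrightarrow>
           measure (run_space R D q)
             {(\<omega>, xs) \<in> space (run_space R D q). run f xs (A \<omega>) 0} \<ge> 2/3) \<and>
        (class_dist D f H \<ge> \<epsilon> \<longrightarrow>
           measure (run_space R D q)
             {(\<omega>, xs) \<in> space (run_space R D q). \<not> run f xs (A \<omega>) 0} \<ge> 2/3))"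

definition q_test :: "real \<Rightarrow> ('a::topological_space \<Rightarrow> bool) set \<Rightarrow> enat" where
  "q_test \<epsilon> H = Inf {enat q | q. \<exists>R A. query_tester \<epsilon> H q R A}"

end

theory Submission
  imports Defs "HOL-Real_Asymp.Real_Asymp"
begin

text \<open>
  Replace each of \<open>N\<close> elements by a pair of adjacent points labelled \<open>1, 0\<close>. If at most \<open>k\<close> elements
  carry mass, the labelling agrees almost surely with a union of \<open>k\<close> intervals; if all \<open>N = (1 + \<Omega>(1)) k\<close>
  elements have mass \<open>\<Omega>(1/N)\<close>, then every union of \<open>k\<close> intervals errs on \<open>N - k\<close> of the pairs. The
  labelling is fixed and only the distribution is unknown, so queries carry no information, and a tester has to
  decide from \<open>t\<close> samples how large the support is.

  Draw the masses \<open>U\<^sub>i / W\<close> independently from one of two priors supported on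
  \<open>16 m\<^sup>2 sin\<^sup>2 (\<pi> j / (8 m))\<close>, \<open>j < 8 m\<close>, where \<open>j\<close> is even for the first prior and odd for the second, and
  let one extra point absorb the remaining mass. With the squared Fejer kernel as weight, the two priors agree
  in the first \<open>2 m\<close> moments and have bounded mean, and only the first one has an atom at \<open>0\<close>, of constant
  size. Replacing one prior by the other in a single coordinate changes the law of \<open>t = O(N / m)\<close> samples only
  by \<open>O(exp (- 2 m))\<close>, because the probability of a sample sequence is a polynomial in that mass.
  For \<open>m\<close> about \<open>ln N\<close> all \<open>N\<close> replacements together stay small.
\<close>

subsection \<open>Two priors with matching moments\<close>

text \<open>A geometric sum whose ratio is an \<open>M\<close>-th root of unity; the ratio differs
  from 1 because \<open>M\<close> does not divide \<open>r\<close>.\<close>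

lemma sum_cis_roots:
  fixes r :: int and M :: nat
  assumes "r \<noteq> 0" "\<bar>r\<bar> < int M"
  shows "(\<Sum>j<M. cis (2 * pi * of_int r * real j / real M)) = 0"
proof -
  define z where "z = cis (2 * pi * of_int r / real M)"
  have M: "M > 0" using assms by auto
  have "z \<noteq> 1"
  proof
    assume "z = 1"
    then have "cos (2 * pi * of_int r / real M) = 1"
      by (simp add: z_def complex_eq_iff)
    then obtain n :: int where "2 * pi * of_int r / real M = of_int n * 2 * pi"
      unfolding cos_one_2pi_int by blast
    then have "real_of_int r = of_int n * real M" using M by (simp add: field_simps)
    then have "real_of_int r = real_of_int (n * int M)" by simp
    then have "r = n * int M" by (simp only: of_int_eq_iff)
    then have "int M dvd r" by simp
    then have "int M \<le> \<bar>r\<bar>" using assms(1) using dvd_imp_le_int[of r "int M"] assms(1) by simp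
    then show False using assms(2) by simp
  qed
  have zM: "z ^ M = 1"
  proof -
    have "z ^ M = cis (2 * pi * of_int r)" unfolding z_def using M by (subst Complex.DeMoivre) simp
    also have "\<dots> = 1" by (rule cis_multiple_2pi) simp
    finally show ?thesis .
  qed
  have "(\<Sum>j<M. cis (2 * pi * of_int r * real j / real M)) = (\<Sum>j<M. z ^ j)"
    by (intro sum.cong refl, unfold z_def, subst Complex.DeMoivre) (simp add: mult_ac)
  also have "\<dots> = 0" using \<open>z \<noteq> 1\<close> zM by (simp add: geometric_sum)
  finally show ?thesis .
qed

text \<open>In the monomial expansion of \<open>P\<close> every exponent \<open>e + i\<close> lies
  strictly between 0 and \<open>M\<close>, so each monomial sums to zero over the
  \<open>M\<close>-th roots of unity.\<close>

lemma sum_roots_poly_eq_0: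
  fixes P :: "complex poly"
  assumes "e > 0" "e + degree P < M"
  shows "(\<Sum>j<M. cis (2 * pi * real j / real M) ^ e * poly P (cis (2 * pi * real j / real M))) = 0"
proof -
  let ?w = "\<lambda>j. cis (2 * pi * real j / real M)"
  have "(\<Sum>j<M. ?w j ^ e * poly P (?w j)) = (\<Sum>j<M. \<Sum>i\<le>degree P. coeff P i * ?w j ^ (e + i))"
    by (simp add: poly_altdef sum_distrib_left power_add mult_ac)
  also have "\<dots> = (\<Sum>i\<le>degree P. coeff P i * (\<Sum>j<M. ?w j ^ (e + i)))"
    by (subst sum.swap) (simp add: sum_distrib_left)
  also have "\<dots> = 0"
  proof (rule sum.neutral, rule ballI)
    fix i assume "i \<in> {..degree P}"
    then have "(\<Sum>j<M. cis (2 * pi * of_int (int (e + i)) * real j / real M)) = 0"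
      using assms by (intro sum_cis_roots) auto
    moreover have "?w j ^ (e + i) = cis (2 * pi * of_int (int (e + i)) * real j / real M)" for j
      by (subst Complex.DeMoivre) (simp add: mult_ac)
    ultimately show "coeff P i * (\<Sum>j<M. ?w j ^ (e + i)) = 0" by simp
  qed
  finally show ?thesis .
qed

section \<open>The Fejer kernel on the roots of unity\<close>

definition dirichlet :: "nat \<Rightarrow> complex \<Rightarrow> complex" where
  "dirichlet m w = (\<Sum>l<m. w ^ l)"

text \<open>The Fejer kernel, normalised (for \<open>m > 0\<close>) to have value 1 at
  \<open>w = 1\<close>.\<close>

definition fejer :: "nat \<Rightarrow> complex \<Rightarrow> real" where
  "fejer m w = (cmod (dirichlet m w))\<^sup>2 / (real m)\<^sup>2"

definition uroot :: "nat \<Rightarrow> nat \<Rightarrow> complex" where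
  "uroot m j = cis (2 * pi * real j / real (8 * m))"

text \<open>A scaled squared chord from 1 to \<open>uroot m j\<close>. The scaling puts all nonzero
  nodes with \<open>j < 8 * m\<close> at 1 or above.\<close>

definition node :: "nat \<Rightarrow> nat \<Rightarrow> real" where
  "node m j = 16 * (real m)\<^sup>2 * (sin (pi * real j / (8 * real m)))\<^sup>2"

text \<open>The square keeps the weighted sum of the nodes bounded: one Fejer factor cancels the
  size of \<open>node\<close>, the other has a bounded sum.\<close>

definition weight :: "nat \<Rightarrow> nat \<Rightarrow> real" where
  "weight m j = (fejer m (uroot m j))\<^sup>2"

lemma fejer_nonneg [simp]: "fejer m w \<ge> 0"
  by (simp add: fejer_def)

lemma fejer_le_1:
  assumes "cmod w = 1"
  shows "fejer m w \<le> 1"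
proof (cases "m = 0")
  case False
  have "cmod (dirichlet m w) \<le> (\<Sum>l<m. cmod (w ^ l))"
    unfolding dirichlet_def by (rule norm_sum)
  also have "\<dots> = real m" using assms by (simp add: norm_power)
  finally have "(cmod (dirichlet m w))\<^sup>2 \<le> (real m)\<^sup>2" by (intro power_mono) auto
  then show ?thesis using False by (simp add: fejer_def)
qed (simp add: fejer_def)

lemma cmod_uroot [simp]: "cmod (uroot m j) = 1"
  by (simp add: uroot_def)

lemma weight_nonneg [simp]: "weight m j \<ge> 0"
  by (simp add: weight_def)

lemma weight_0:
  assumes "m > 0"
  shows "weight m 0 = 1"
  using assms by (simp add: weight_def fejer_def dirichlet_def uroot_def)

lemma weight_le_fejer: "weight m j \<le> fejer m (uroot m j)"
  unfolding weight_def power2_eq_square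
  by (rule mult_left_le) (auto intro: fejer_le_1)

text \<open>Parseval on the group of \<open>8m\<close>-th roots of unity.\<close>

lemma sum_fejer:
  assumes "m > 0"
  shows "(\<Sum>j<8*m. fejer m (uroot m j)) = 8"
proof -
  have *: "complex_of_real ((cmod (dirichlet m (uroot m j)))\<^sup>2) =
      (\<Sum>l<m. \<Sum>l'<m. cis (2 * pi * of_int (int l - int l') * real j / real (8 * m)))" for j
  proof -
    have "complex_of_real ((cmod (dirichlet m (uroot m j)))\<^sup>2) =
        dirichlet m (uroot m j) * cnj (dirichlet m (uroot m j))"
      by (rule complex_norm_square)
    also have "\<dots> = (\<Sum>l<m. \<Sum>l'<m. uroot m j ^ l * cnj (uroot m j) ^ l')"
      by (simp add: dirichlet_def sum_product)
    also have "\<dots> = (\<Sum>l<m. \<Sum>l'<m. cis (2 * pi * of_int (int l - int l') * real j / real (8 * m)))"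
    proof (intro sum.cong refl)
      fix l l' :: nat
      have "2 * pi * of_int (int l - int l') * real j / real (8 * m) =
          real l * (2 * pi * real j / real (8 * m)) + real l' * (- (2 * pi * real j / real (8 * m)))"
        by (simp add: algebra_simps diff_divide_distrib)
      then show "uroot m j ^ l * cnj (uroot m j) ^ l' =
          cis (2 * pi * of_int (int l - int l') * real j / real (8 * m))"
        unfolding uroot_def cis_cnj Complex.DeMoivre cis_mult by (rule arg_cong[OF sym])
    qed
    finally show ?thesis .
  qed
  have "complex_of_real (\<Sum>j<8*m. (cmod (dirichlet m (uroot m j)))\<^sup>2) =
      (\<Sum>j<8*m. complex_of_real ((cmod (dirichlet m (uroot m j)))\<^sup>2))" by simp
  also have "\<dots> = (\<Sum>l<m. \<Sum>j<8*m. \<Sum>l'<m.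
      cis (2 * pi * of_int (int l - int l') * real j / real (8 * m)))"
    unfolding * by (rule sum.swap)
  also have "\<dots> = (\<Sum>l<m. \<Sum>l'<m. \<Sum>j<8*m.
      cis (2 * pi * of_int (int l - int l') * real j / real (8 * m)))"
    by (rule sum.cong[OF refl], rule sum.swap)
  also have "\<dots> = (\<Sum>l<m. \<Sum>l'<m. if l = l' then of_nat (8 * m) else 0)"
  proof (intro sum.cong refl)
    fix l l' assume "l \<in> {..<m}" "l' \<in> {..<m}"
    then show "(\<Sum>j<8*m. cis (2 * pi * of_int (int l - int l') * real j / real (8 * m))) =
        (if l = l' then of_nat (8 * m) else 0)"
      using sum_cis_roots[of "int l - int l'" "8 * m"] by (cases "l = l'") auto
  qed
  also have "\<dots> = complex_of_real (8 * (real m)\<^sup>2)"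
    by (simp add: power2_eq_square)
  finally have "(\<Sum>j<8*m. (cmod (dirichlet m (uroot m j)))\<^sup>2) = 8 * (real m)\<^sup>2"
    using of_real_eq_iff by blast
  then show ?thesis using assms
    by (simp add: fejer_def flip: sum_divide_distrib)
qed

text \<open>Since |exp(2ia) - 1| = 2 |sin a|. In this form the node is visibly a Laurent polynomial
  in the root of unity.\<close>

lemma node_uroot: "node m j = 4 * (real m)\<^sup>2 * (cmod (uroot m j - 1))\<^sup>2"
proof -
  let ?a = "pi * real j / (8 * real m)"
  have r: "uroot m j = cis (2 * ?a)" by (simp add: uroot_def)
  have "(cmod (uroot m j - 1))\<^sup>2 = (cos (2 * ?a) - 1)\<^sup>2 + (sin (2 * ?a))\<^sup>2"
    unfolding r by (simp add: cmod_power2)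
  also have "\<dots> = 2 - 2 * cos (2 * ?a)"
    using sin_cos_squared_add[of "2 * ?a"] by (simp add: power2_eq_square algebra_simps)
  also have "\<dots> = 4 * (sin ?a)\<^sup>2"
    using cos_double_sin[of ?a] by (simp add: mult.assoc)
  finally show ?thesis by (simp add: node_def)
qed

section \<open>Location of the nodes and their weighted sum\<close>

lemma node_nonneg [simp]: "node m j \<ge> 0"
  by (simp add: node_def)

lemma node_0 [simp]: "node m 0 = 0"
  by (simp add: node_def)

lemma node_le: "node m j \<le> 16 * (real m)\<^sup>2"
  unfolding node_def by (rule mult_left_le) (auto simp: abs_square_le_1 power2_eq_square[symmetric])

text \<open>Jordan's inequality: sine is concave on [0, pi/2] and so lies above its chord
  there.\<close>

lemma sin_ge_linear:
  fixes x :: real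
  assumes "0 \<le> x" "x \<le> pi / 2"
  shows "sin x \<ge> 2 * x / pi"
proof -
  have "convex_on {0..pi/2} (\<lambda>x::real. - sin x)"
    by (rule f''_ge0_imp_convex[where f' = "\<lambda>x. - cos x" and f'' = "\<lambda>x. sin x"])
      (auto intro!: derivative_eq_intros sin_ge_zero)
  then have "- sin ((1 - 2 * x / pi) *\<^sub>R 0 + (2 * x / pi) *\<^sub>R (pi / 2)) \<le>
      (1 - 2 * x / pi) * (- sin 0) + (2 * x / pi) * (- sin (pi / 2))"
    by (rule convex_onD) (use assms in \<open>auto simp: field_simps\<close>)
  then show ?thesis by simp
qed

text \<open>Jordan's inequality, after reflecting indices above \<open>4 * m\<close> to
  \<open>8 * m - j\<close>. This gap above the node 0 is what gives every element a mass of order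
  1/N under the second prior.\<close>

lemma node_ge_1:
  assumes "0 < j" "j < 8 * m"
  shows "node m j \<ge> 1"
proof -
  have m: "m > 0" using assms by simp
  have *: "sin (pi * real i / (8 * real m)) \<ge> 1 / (4 * real m)" if "0 < i" "i \<le> 4 * m" for i
  proof -
    have i: "1 \<le> real i" "real i \<le> 4 * real m" using that by linarith+
    have "1 / (4 * real m) \<le> 2 * (pi * real i / (8 * real m)) / pi"
      using i m by (simp add: field_simps)
    also have "\<dots> \<le> sin (pi * real i / (8 * real m))"
      using i m by (intro sin_ge_linear) (auto simp: field_simps)
    finally show ?thesis .
  qed
  have "sin (pi * real j / (8 * real m)) \<ge> 1 / (4 * real m)"
  proof (cases "j \<le> 4 * m")
    case False
    have "pi * real j / (8 * real m) = pi - pi * real (8 * m - j) / (8 * real m)"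
      using assms m by (simp add: of_nat_diff field_simps)
    then have "sin (pi * real j / (8 * real m)) = sin (pi * real (8 * m - j) / (8 * real m))"
      by simp
    then show ?thesis using *[of "8 * m - j"] assms False by simp
  qed (use * assms in blast)
  then have "(sin (pi * real j / (8 * real m)))\<^sup>2 \<ge> (1 / (4 * real m))\<^sup>2"
    by (intro power_mono) auto
  then show ?thesis using m by (simp add: node_def field_simps)
qed

text \<open>The geometric sum gives \<open>dirichlet m w * (w - 1) = w ^ m - 1\<close>, of modulus
  at most 2, so one Fejer factor times the node is at most 16. The other factor sums to 8.\<close>

lemma sum_weight_node_le:
  assumes "m > 0"
  shows "(\<Sum>j<8*m. weight m j * node m j) \<le> 128"
proof -
  have "weight m j * node m j \<le> 16 * fejer m (uroot m j)" for j
  proof -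
    let ?w = "uroot m j"
    have "dirichlet m ?w * (?w - 1) = ?w ^ m - 1"
      unfolding dirichlet_def power_diff_1_eq[of _ m] by (rule mult.commute)
    then have "cmod (dirichlet m ?w) * cmod (?w - 1) = cmod (?w ^ m - 1)"
      by (simp only: norm_mult[symmetric])
    also have "\<dots> \<le> cmod (?w ^ m) + cmod 1" by (rule norm_triangle_ineq4)
    also have "\<dots> = 2" by (simp add: norm_power)
    finally have "(cmod (dirichlet m ?w) * cmod (?w - 1))\<^sup>2 \<le> 2\<^sup>2"
      by (intro power_mono) auto
    moreover have "fejer m ?w * node m j = 4 * (cmod (dirichlet m ?w) * cmod (?w - 1))\<^sup>2"
      using assms by (simp add: fejer_def node_uroot power_mult_distrib)
    ultimately have "fejer m ?w * node m j \<le> 16" by simp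
    then have "fejer m ?w * (fejer m ?w * node m j) \<le> fejer m ?w * 16"
      by (rule mult_left_mono) simp
    then show ?thesis by (simp add: weight_def power2_eq_square mult_ac)
  qed
  then have "(\<Sum>j<8*m. weight m j * node m j) \<le> (\<Sum>j<8*m. 16 * fejer m (uroot m j))"
    by (intro sum_mono) auto
  also have "\<dots> = 128" using sum_fejer[OF assms] by (simp flip: sum_distrib_left)
  finally show ?thesis .
qed

text \<open>On the unit circle conjugation is inversion, so multiplying the conjugated kernel by
  \<open>w ^ (m - 1)\<close> reverses its coefficients, which are all 1. This clears the negative
  powers of \<open>w\<close>.\<close>

lemma fejer_times_power:
  assumes "cmod w = 1" "m > 0"
  shows "w ^ (m - 1) * of_real (fejer m w) = dirichlet m w ^ 2 / (of_nat m)\<^sup>2"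
proof -
  have w: "cnj w * w = 1" using complex_norm_square[of w] assms(1) by (simp add: mult.commute)
  have "w ^ (m - 1) * cnj (dirichlet m w) = (\<Sum>l<m. w ^ (m - 1 - l))"
    unfolding dirichlet_def cnj_sum sum_distrib_left
  proof (intro sum.cong refl)
    fix l assume "l \<in> {..<m}"
    then have "w ^ (m - 1) = w ^ (m - 1 - l) * w ^ l" by (simp flip: power_add)
    then show "w ^ (m - 1) * cnj (w ^ l) = w ^ (m - 1 - l)"
      using w by (simp add: mult.assoc mult.commute flip: power_mult_distrib)
  qed
  also have "\<dots> = dirichlet m w"
    unfolding dirichlet_def using sum.nat_diff_reindex[of "\<lambda>l. w ^ l" m] by simp
  finally have *: "w ^ (m - 1) * cnj (dirichlet m w) = dirichlet m w" .
  have "complex_of_real ((cmod (dirichlet m w))\<^sup>2) = dirichlet m w * cnj (dirichlet m w)"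
    by (rule complex_norm_square)
  then have "w ^ (m - 1) * of_real (fejer m w) = 
     dirichlet m w * (w ^ (m - 1) * cnj (dirichlet m w)) / (of_nat m)\<^sup>2"
    by (simp add: fejer_def)
  then show ?thesis unfolding * by (simp add: power2_eq_square)
qed

text \<open>A single factor \<open>w\<close> clears the negative power in the node, because w |w -
  1|^2 = - (w - 1)^2 when |w| = 1.\<close>

lemma uroot_times_node:
  "uroot m j * of_real (node m j) = - 4 * (of_nat m)\<^sup>2 * (uroot m j - 1)\<^sup>2"
proof -
  let ?w = "uroot m j"
  have w: "?w * cnj ?w = 1" using complex_norm_square[of ?w] by simp
  have "?w * of_real ((cmod (?w - 1))\<^sup>2) = (?w - 1) * (?w * cnj ?w - ?w)"
    unfolding complex_norm_square by (simp add: algebra_simps)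
  also have "\<dots> = - (?w - 1)\<^sup>2" unfolding w by (simp add: power2_eq_square algebra_simps)
  finally have "?w * of_real ((cmod (?w - 1))\<^sup>2) = - (?w - 1)\<^sup>2" .
  then show ?thesis unfolding node_uroot
    by (simp add: mult.left_commute[of ?w] mult.assoc)
qed

text \<open>
  On the \<open>8m\<close>-th roots of unity \<open>w\<close>, the sign \<open>(-1)\<^sup>j\<close> equals \<open>w\<^sup>4\<^sup>m\<close>, while weight times \<open>a\<close>-th power of the
  node is a Laurent polynomial of degree at most \<open>2 (m - 1) + a < 4 m\<close>; so only powers \<open>w\<^sup>e\<close> with \<open>0 < e < 8 m\<close> occur.
\<close>

lemma sum_alternating_weight_node_power:
  assumes "m > 0" "a < 2 * m"
  shows "(\<Sum>j<8*m. (-1) ^ j * weight m j * node m j ^ a) = 0"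
proof -
  \<comment> \<open>Of the \<open>4 * m\<close> factors \<open>w\<close> that encode the sign,
    \<open>2 * (m - 1)\<close> clear the denominators of the squared Fejer kernel and
    \<open>a\<close> those of the nodes; \<open>e\<close> factors are left.\<close>
  define e where "e = 4 * m - 2 * (m - 1) - a"
  define P :: "complex poly" where
    "P = smult ((- 4 * (of_nat m)\<^sup>2) ^ a / (of_nat m) ^ 4) ((\<Sum>l<m. monom 1 l) ^ 4 * [:-1, 1:] ^ (2 * a))"
  have poly_P: "poly P w = (- 4 * (of_nat m)\<^sup>2) ^ a / (of_nat m) ^ 4 * (dirichlet m w ^ 4 * (w - 1) ^ (2 * a))" for w
    by (simp add: P_def poly_sum poly_monom dirichlet_def)
  have "degree (\<Sum>l<m. monom (1::complex) l) \<le> m - 1"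
    by (rule degree_sum_le) (auto intro: order.trans[OF degree_monom_le])
  then have "degree ((\<Sum>l<m. monom (1::complex) l) ^ 4) \<le> (m - 1) * 4"
    by (intro order.trans[OF degree_power_le] mult_le_mono1)
  moreover have "degree ([:-1, 1::complex:] ^ (2 * a)) \<le> 2 * a"
    by (simp add: degree_linear_power)
  ultimately have "degree P \<le> (m - 1) * 4 + 2 * a"
    unfolding P_def by (intro order.trans[OF degree_smult_le] order.trans[OF degree_mult_le] add_mono)
  then have deg: "e + degree P < 8 * m" using assms by (auto simp: e_def)
  have e: "e > 0" "e + (2 * (m - 1) + a) = 4 * m" using assms by (auto simp: e_def)
  have rearrange: "(D\<^sup>2 / M\<^sup>2)\<^sup>2 * (c * v\<^sup>2) ^ a = c ^ a / M ^ 4 * (D ^ 4 * v ^ (2 * a))"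
    for c D v M :: complex
    by (simp add: power_mult_distrib power_divide flip: power_mult)
  have "complex_of_real ((-1) ^ j * weight m j * node m j ^ a) = uroot m j ^ e * poly P (uroot m j)" for j
  proof -
    let ?w = "uroot m j"
    have "?w ^ (4 * m) = cis (real (4 * m) * (2 * pi * real j / real (8 * m)))"
      unfolding uroot_def by (rule Complex.DeMoivre)
    also have "real (4 * m) * (2 * pi * real j / real (8 * m)) = real j * pi"
      using assms(1) by (simp add: field_simps)
    also have "cis (real j * pi) = (-1) ^ j"
      by (simp only: Complex.DeMoivre[symmetric] cis_pi)
    finally have "complex_of_real ((-1) ^ j) = ?w ^ (4 * m)" by simp
    also have "\<dots> = ?w ^ e * ((?w ^ (m - 1)) ^ 2 * ?w ^ a)"
      unfolding e(2)[symmetric] by (simp only: power_add power_even_eq)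
    finally have "complex_of_real ((-1) ^ j * weight m j * node m j ^ a) =
       ?w ^ e * ((?w ^ (m - 1))\<^sup>2 * ?w ^ a) * (of_real (fejer m ?w))\<^sup>2 * of_real (node m j) ^ a"
      by (simp only: of_real_mult of_real_power weight_def)
    also have "\<dots> = ?w ^ e * ((?w ^ (m - 1) * of_real (fejer m ?w)) ^ 2 * (?w * of_real (node m j)) ^ a)"
      by (simp only: power_mult_distrib mult_ac)
    also have "\<dots> = ?w ^ e * poly P ?w"
      unfolding poly_P uroot_times_node fejer_times_power[OF cmod_uroot assms(1)] rearrange ..
    finally show ?thesis .
  qed
  then have "complex_of_real (\<Sum>j<8*m. (-1) ^ j * weight m j * node m j ^ a) =
     (\<Sum>j<8*m. uroot m j ^ e * poly P (uroot m j))"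
    by (simp add: of_real_sum)
  also have "\<dots> = 0"
    unfolding uroot_def by (rule sum_roots_poly_eq_0[OF e(1) deg])
  finally show ?thesis using of_real_eq_0_iff by blast
qed

subsection \<open>Changing the mass of a single element\<close>

text \<open>For \<open>z \<ge> 0\<close>, \<open>poly (abs_poly p) z\<close> is the weighted l1 norm
  of the coefficients of \<open>p\<close>. It is submultiplicative, so products can be bounded
  factor by factor.\<close>

definition abs_poly :: "real poly \<Rightarrow> real poly" where
  "abs_poly = map_poly abs"

lemma coeff_abs_poly [simp]: "coeff (abs_poly p) i = \<bar>coeff p i\<bar>"
  by (simp add: abs_poly_def coeff_map_poly)

lemma degree_abs_poly [simp]: "degree (abs_poly p) = degree p"
  by (cases "p = 0") (auto simp: abs_poly_def map_poly_degree_eq)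

lemma abs_poly_pCons [simp]: "abs_poly (pCons a p) = pCons \<bar>a\<bar> (abs_poly p)"
  by (rule poly_eqI) (simp add: coeff_pCons split: nat.split)

lemma abs_poly_0 [simp]: "abs_poly 0 = 0"
  by (rule poly_eqI) simp

lemma abs_poly_1 [simp]: "abs_poly 1 = 1"
  by (simp add: one_pCons)

lemma poly_nonneg_coeffs:
  fixes z :: real
  assumes "\<And>i. coeff p i \<ge> 0" "z \<ge> 0"
  shows "poly p z \<ge> 0"
  unfolding poly_altdef using assms by (intro sum_nonneg) auto

lemma poly_abs_poly_mult_le:
  assumes "z \<ge> 0"
  shows "poly (abs_poly (p * q)) z \<le> poly (abs_poly p) z * poly (abs_poly q) z"
proof -
  have "poly (abs_poly p * abs_poly q - abs_poly (p * q)) z \<ge> 0"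
  proof (rule poly_nonneg_coeffs[OF _ assms])
    fix i
    have "\<bar>coeff (p * q) i\<bar> \<le> (\<Sum>j\<le>i. \<bar>coeff p j * coeff q (i - j)\<bar>)"
      unfolding coeff_mult by (rule sum_abs)
    then show "coeff (abs_poly p * abs_poly q - abs_poly (p * q)) i \<ge> 0"
      by (simp add: coeff_mult abs_mult)
  qed
  then show ?thesis by simp
qed

lemma poly_abs_poly_nonneg: "z \<ge> 0 \<Longrightarrow> poly (abs_poly p) z \<ge> 0"
  by (rule poly_nonneg_coeffs) auto

lemma poly_abs_poly_prod_le:
  assumes "z \<ge> 0" "finite I"
  shows "poly (abs_poly (\<Prod>i\<in>I. p i)) z \<le> (\<Prod>i\<in>I. poly (abs_poly (p i)) z)"
  using assms(2)
proof induction
  case (insert i I)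
  have "poly (abs_poly (p i * (\<Prod>i\<in>I. p i))) z \<le> poly (abs_poly (p i)) z * poly (abs_poly (\<Prod>i\<in>I. p i)) z"
    by (rule poly_abs_poly_mult_le[OF assms(1)])
  also have "\<dots> \<le> poly (abs_poly (p i)) z * (\<Prod>i\<in>I. poly (abs_poly (p i)) z)"
    by (intro mult_left_mono insert poly_abs_poly_nonneg assms)
  finally show ?case using insert by simp
qed simp

text \<open>
  Only the terms of degree at least \<open>L\<close> survive, and there \<open>Y ^ i \<le> (Y / z) ^ L * z ^ i\<close>.
\<close>

lemma moment_functional_bound:
  fixes c v :: "'j \<Rightarrow> real"
  assumes "finite J" and zero: "\<And>a. a < L \<Longrightarrow> (\<Sum>j\<in>J. c j * v j ^ a) = 0"
    and v: "\<And>j. j \<in> J \<Longrightarrow> 0 \<le> v j \<and> v j \<le> Y" and Y: "0 \<le> Y" "Y \<le> z" "0 < z"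
  shows "\<bar>\<Sum>j\<in>J. c j * poly p (v j)\<bar> \<le> (\<Sum>j\<in>J. \<bar>c j\<bar>) * (Y / z) ^ L * poly (abs_poly p) z"
proof -
  define C where "C = (\<Sum>j\<in>J. \<bar>c j\<bar>)"
  have C: "C \<ge> 0" unfolding C_def by (simp add: sum_nonneg)
  have mom: "\<bar>\<Sum>j\<in>J. c j * v j ^ i\<bar> \<le> C * (Y / z) ^ L * z ^ i" for i
  proof (cases "i < L")
    case True
    then show ?thesis using zero C Y by simp
  next
    case False
    have "\<bar>\<Sum>j\<in>J. c j * v j ^ i\<bar> \<le> (\<Sum>j\<in>J. \<bar>c j * v j ^ i\<bar>)" by (rule sum_abs)
    also have "\<dots> \<le> (\<Sum>j\<in>J. \<bar>c j\<bar> * Y ^ i)"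
      using v by (intro sum_mono) (auto simp: abs_mult intro!: mult_left_mono power_mono)
    also have "\<dots> = C * ((Y / z) ^ i * z ^ i)"
      using Y by (simp add: C_def sum_distrib_right power_divide)
    also have "\<dots> \<le> C * ((Y / z) ^ L * z ^ i)"
      using C Y False by (intro mult_left_mono mult_right_mono power_decreasing) auto
    finally show ?thesis by (simp add: mult.assoc)
  qed
  have "(\<Sum>j\<in>J. c j * poly p (v j)) = (\<Sum>i\<le>degree p. coeff p i * (\<Sum>j\<in>J. c j * v j ^ i))"
    unfolding poly_altdef sum_distrib_left by (subst sum.swap) (simp add: mult_ac)
  also have "\<bar>\<dots>\<bar> \<le> (\<Sum>i\<le>degree p. \<bar>coeff p i\<bar> * \<bar>\<Sum>j\<in>J. c j * v j ^ i\<bar>)"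
    by (rule order.trans[OF sum_abs]) (simp add: abs_mult)
  also have "\<dots> \<le> (\<Sum>i\<le>degree p. \<bar>coeff p i\<bar> * (C * (Y / z) ^ L * z ^ i))"
    by (intro sum_mono mult_left_mono mom) auto
  also have "\<dots> = C * (Y / z) ^ L * poly (abs_poly p) z"
    by (simp add: poly_altdef sum_distrib_left mult_ac)
  finally show ?thesis unfolding C_def .
qed

text \<open>
  Element \<open>i < N\<close> corresponds to the points \<open>2 * i\<close> and \<open>2 * i + 1\<close>; the point \<open>2 * N\<close> absorbs the rest. The
  parameter \<open>acc\<close> of \<open>accept\<close> stands for the acceptance probability given the sample sequence.
\<close>

definition pair_mass :: "nat \<Rightarrow> (nat \<Rightarrow> real) \<Rightarrow> nat \<Rightarrow> real" where
  "pair_mass N y p = (if p < 2 * N then y (p div 2) / 2 else 1 - (\<Sum>i<N. y i))"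

definition accept :: "nat \<Rightarrow> ((nat \<Rightarrow> nat) \<Rightarrow> real) \<Rightarrow> nat \<Rightarrow> (nat \<Rightarrow> real) \<Rightarrow> real" where
  "accept t acc N y = (\<Sum>s\<in>PiE {..<t} (\<lambda>_. {..2 * N}). acc s * (\<Prod>r<t. pair_mass N y (s r)))"

lemma sum_div_2:
  fixes h :: "nat \<Rightarrow> real"
  shows "(\<Sum>p<2 * N. h (p div 2) / 2) = (\<Sum>i<N. h i)"
  by (induction N) auto

lemma sum_pair_mass: "(\<Sum>p\<le>2 * N. pair_mass N y p) = 1"
proof -
  have "(\<Sum>p\<le>2 * N. pair_mass N y p) = (\<Sum>p<2 * N. y (p div 2) / 2) + (1 - (\<Sum>i<N. y i))"
    by (simp add: pair_mass_def lessThan_Suc_atMost[symmetric])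
  then show ?thesis by (simp add: sum_div_2)
qed

lemma pair_mass_nonneg:
  assumes "\<And>i. i < N \<Longrightarrow> y i \<ge> 0" "(\<Sum>i<N. y i) \<le> 1"
  shows "pair_mass N y p \<ge> 0"
  using assms by (auto simp: pair_mass_def)

lemma accept_bounds:
  assumes "\<And>i. i < N \<Longrightarrow> y i \<ge> 0" "(\<Sum>i<N. y i) \<le> 1" "\<And>s. 0 \<le> acc s \<and> acc s \<le> 1"
  shows "0 \<le> accept t acc N y" "accept t acc N y \<le> 1"
proof -
  show "0 \<le> accept t acc N y" unfolding accept_def
    using assms by (intro sum_nonneg mult_nonneg_nonneg prod_nonneg) (auto simp: pair_mass_nonneg)
  have "accept t acc N y \<le> (\<Sum>s\<in>PiE {..<t} (\<lambda>_. {..2 * N}). 1 * (\<Prod>r<t. pair_mass N y (s r)))"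
    unfolding accept_def
    using assms by (intro sum_mono mult_right_mono prod_nonneg) (auto simp: pair_mass_nonneg)
  also have "\<dots> = (\<Prod>r<t. \<Sum>p\<le>2 * N. pair_mass N y p)"
    by (subst prod_sum_PiE) auto
  also have "\<dots> = 1" by (simp add: sum_pair_mass)
  finally show "accept t acc N y \<le> 1" .
qed

text \<open>As a function of the mass of element \<open>i\<close> alone, the probability of a sample
  sequence is a product of \<open>t\<close> polynomials of degree at most 1. The moment bound
  applies to each product, and the coefficient norms, summed over all sequences, factor into a
  \<open>t\<close>-th power.\<close>

lemma accept_change_coordinate:
  fixes c v :: "nat \<Rightarrow> real"
  assumes "finite J" and zero: "\<And>a. a < L \<Longrightarrow> (\<Sum>j\<in>J. c j * v j ^ a) = 0"
    and v: "\<And>j. j \<in> J \<Longrightarrow> 0 \<le> v j \<and> v j \<le> Y" and Y: "0 \<le> Y" "Y \<le> z" "0 < z"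
    and i: "i < N" and y: "\<And>l. l < N \<Longrightarrow> y l \<ge> 0" "(\<Sum>l\<in>{..<N} - {i}. y l) \<le> 1"
    and acc: "\<And>s. 0 \<le> acc s \<and> acc s \<le> 1"
  shows "\<bar>\<Sum>j\<in>J. c j * accept t acc N (y(i := v j))\<bar> \<le>
     (\<Sum>j\<in>J. \<bar>c j\<bar>) * (Y / z) ^ L * (1 + 2 * z) ^ t"
proof -
  let ?S = "PiE {..<t} (\<lambda>_. {..2 * N})"
  define K where "K = (\<Sum>j\<in>J. \<bar>c j\<bar>) * (Y / z) ^ L"
  have K: "K \<ge> 0" unfolding K_def using Y by (auto intro!: mult_nonneg_nonneg sum_nonneg)
  define R where "R = (\<Sum>l\<in>{..<N} - {i}. y l)"
  \<comment> \<open>The mass of point \<open>p\<close> as a polynomial in the mass of element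
    \<open>i\<close>; only the two points of that element and the absorbing point depend on
    it.\<close>
  define g :: "nat \<Rightarrow> real poly" where
    "g p = (if p < 2 * N then if p div 2 = i then [:0, 1/2:] else [:y (p div 2) / 2:] else [:1 - R, -1:])" for p
  have R: "(\<Sum>l<N. (y(i := x)) l) = x + R" for x
    unfolding R_def using i by (subst sum.remove[of _ i]) auto
  have g: "poly (g p) x = pair_mass N (y(i := x)) p" for p x
    by (auto simp: g_def pair_mass_def R[simplified])
  \<comment> \<open>The pair of element \<open>i\<close> contributes \<open>z\<close>, the other
    pairs \<open>R\<close>, and the absorbing point \<open>1 - R + z\<close>, since its coefficient
    -1 enters with absolute value 1.\<close>
  have gz: "(\<Sum>p\<le>2 * N. poly (abs_poly (g p)) z) = 1 + 2 * z"
  proof -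
    have "(\<Sum>p\<le>2 * N. poly (abs_poly (g p)) z) =
       (\<Sum>p<2 * N. (y(i := z)) (p div 2) / 2) + ((1 - R) + z)"
      unfolding lessThan_Suc_atMost[symmetric] sum.lessThan_Suc
    proof (intro arg_cong2[of _ _ _ _ "(+)"] sum.cong refl)
      fix p assume "p \<in> {..<2 * N}"
      then show "poly (abs_poly (g p)) z = (y(i := z)) (p div 2) / 2"
        using y(1)[of "p div 2"] by (auto simp: g_def)
    qed (use y in \<open>simp add: g_def R_def\<close>)
    also have "\<dots> = 1 + 2 * z" unfolding sum_div_2 R by simp
    finally show ?thesis .
  qed
  have "(\<Sum>j\<in>J. c j * accept t acc N (y(i := v j))) =
      (\<Sum>s\<in>?S. acc s * (\<Sum>j\<in>J. c j * poly (\<Prod>r<t. g (s r)) (v j)))"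
    unfolding accept_def sum_distrib_left poly_prod g by (subst sum.swap) (simp add: mult_ac)
  also have "\<bar>\<dots>\<bar> \<le> (\<Sum>s\<in>?S. 1 * (K * (\<Prod>r<t. poly (abs_poly (g (s r))) z)))"
  proof (rule order.trans[OF sum_abs], rule sum_mono)
    fix s assume "s \<in> ?S"
    have "\<bar>\<Sum>j\<in>J. c j * poly (\<Prod>r<t. g (s r)) (v j)\<bar> \<le> K * poly (abs_poly (\<Prod>r<t. g (s r))) z"
      unfolding K_def by (rule moment_functional_bound) (use assms in auto)
    also have "\<dots> \<le> K * (\<Prod>r<t. poly (abs_poly (g (s r))) z)"
      using Y K by (intro mult_left_mono poly_abs_poly_prod_le) auto
    finally show "\<bar>acc s * (\<Sum>j\<in>J. c j * poly (\<Prod>r<t. g (s r)) (v j))\<bar> \<le>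
        1 * (K * (\<Prod>r<t. poly (abs_poly (g (s r))) z))"
      unfolding abs_mult using acc[of s] by (intro mult_mono) auto
  qed
  also have "\<dots> = K * (\<Prod>r<t. \<Sum>p\<le>2 * N. poly (abs_poly (g p)) z)"
    by (subst prod_sum_PiE) (auto simp: sum_distrib_left)
  also have "\<dots> = K * (1 + 2 * z) ^ t" unfolding gz by simp
  finally show ?thesis unfolding K_def .
qed

subsection \<open>Replacing one product prior by another\<close>

text \<open>Expectation over independent coordinates. The law may vary with the coordinate so that
  mixtures of two product priors are covered.\<close>

definition expect :: "'i set \<Rightarrow> 'j set \<Rightarrow> ('i \<Rightarrow> 'j \<Rightarrow> real) \<Rightarrow> (('i \<Rightarrow> 'j) \<Rightarrow> real) \<Rightarrow> real" where
  "expect I J \<rho> F = (\<Sum>u\<in>PiE I (\<lambda>_. J). (\<Prod>l\<in>I. \<rho> l (u l)) * F u)"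

lemma expect_mono:
  assumes "\<And>l j. l \<in> I \<Longrightarrow> j \<in> J \<Longrightarrow> \<rho> l j \<ge> 0" "\<And>u. u \<in> PiE I (\<lambda>_. J) \<Longrightarrow> F u \<le> G u"
  shows "expect I J \<rho> F \<le> expect I J \<rho> G"
  unfolding expect_def
  using assms by (intro sum_mono mult_left_mono prod_nonneg) (auto dest: PiE_mem)

lemma expect_add: "expect I J \<rho> (\<lambda>u. F u + G u) = expect I J \<rho> F + expect I J \<rho> G"
  by (simp add: expect_def distrib_left sum.distrib)

lemma expect_cmult: "expect I J \<rho> (\<lambda>u. c * F u) = c * expect I J \<rho> F"
  by (simp add: expect_def sum_distrib_left mult_ac)

lemma expect_prod:
  assumes "finite I" "finite J"
  shows "expect I J \<rho> (\<lambda>u. \<Prod>l\<in>I. h (u l)) = (\<Prod>l\<in>I. \<Sum>j\<in>J. \<rho> l j * h j)"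
  using assms by (simp add: expect_def prod_sum_PiE prod.distrib)

lemma expect_const:
  assumes "finite I" "finite J" "\<And>l. l \<in> I \<Longrightarrow> (\<Sum>j\<in>J. \<rho> l j) = 1"
  shows "expect I J \<rho> (\<lambda>_. c) = c"
proof -
  have "expect I J \<rho> (\<lambda>_. c) = c * expect I J \<rho> (\<lambda>u. \<Prod>l\<in>I. 1)"
    by (simp flip: expect_cmult)
  also have "\<dots> = c" using expect_prod[of I J \<rho> "\<lambda>_. 1"] assms by simp
  finally show ?thesis .
qed

text \<open>Fubini: the coordinate \<open>i\<close> is averaged first, which isolates the effect of
  changing its law.\<close>

lemma expect_insert:
  assumes "finite I" "finite J" "i \<notin> I"
  shows "expect (insert i I) J \<rho> F = expect I J \<rho> (\<lambda>v. \<Sum>j\<in>J. \<rho> i j * F (v(i := j)))"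
proof -
  have inj: "inj_on (\<lambda>(j, v). v(i := j)) (J \<times> PiE I (\<lambda>_. J))"
    using inj_combinator[OF assms(3), of "\<lambda>_. J"] .
  have "expect (insert i I) J \<rho> F =
      (\<Sum>(j, v)\<in>J \<times> PiE I (\<lambda>_. J). (\<Prod>l\<in>insert i I. \<rho> l ((v(i := j)) l)) * F (v(i := j)))"
    unfolding expect_def PiE_insert_eq sum.reindex[OF inj] by (simp add: case_prod_unfold o_def)
  also have "\<dots> = (\<Sum>(j, v)\<in>J \<times> PiE I (\<lambda>_. J). (\<Prod>l\<in>I. \<rho> l (v l)) * (\<rho> i j * F (v(i := j))))"
  proof (intro sum.cong refl, clarify)
    fix j v
    have "(\<Prod>l\<in>I. \<rho> l ((v(i := j)) l)) = (\<Prod>l\<in>I. \<rho> l (v l))"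
      using assms(3) by (intro prod.cong) auto
    then show "(\<Prod>l\<in>insert i I. \<rho> l ((v(i := j)) l)) * F (v(i := j)) =
       (\<Prod>l\<in>I. \<rho> l (v l)) * (\<rho> i j * F (v(i := j)))"
      using assms by simp
  qed
  also have "\<dots> = expect I J \<rho> (\<lambda>v. \<Sum>j\<in>J. \<rho> i j * F (v(i := j)))"
    unfolding expect_def sum.cartesian_product[symmetric] sum_distrib_left by (rule sum.swap)
  finally show ?thesis .
qed

text \<open>Chernoff's bound: the indicator is at most \<open>exp (\<theta> * (sum - B))\<close>,
  whose expectation factorises by independence.\<close>

lemma expect_tail:
  assumes "finite I" "finite J" "\<And>l j. l \<in> I \<Longrightarrow> j \<in> J \<Longrightarrow> \<rho> l j \<ge> 0" and "\<theta> \<ge> 0"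
    and mgf: "\<And>l. l \<in> I \<Longrightarrow> (\<Sum>j\<in>J. \<rho> l j * exp (\<theta> * f j)) \<le> exp \<kappa>"
  shows "expect I J \<rho> (\<lambda>u. of_bool (B < (\<Sum>l\<in>I. f (u l)))) \<le> exp (\<kappa> * real (card I) - \<theta> * B)"
proof -
  have "expect I J \<rho> (\<lambda>u. of_bool (B < (\<Sum>l\<in>I. f (u l)))) \<le>
      expect I J \<rho> (\<lambda>u. exp (- \<theta> * B) * (\<Prod>l\<in>I. exp (\<theta> * f (u l))))"
  proof (rule expect_mono)
    fix u
    have "exp (- \<theta> * B) * (\<Prod>l\<in>I. exp (\<theta> * f (u l))) = exp (\<theta> * ((\<Sum>l\<in>I. f (u l)) - B))"
      using assms(1) by (simp add: exp_sum[symmetric] sum_distrib_left[symmetric] algebra_simps flip: exp_add)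
    then show "of_bool (B < (\<Sum>l\<in>I. f (u l))) \<le> exp (- \<theta> * B) * (\<Prod>l\<in>I. exp (\<theta> * f (u l)))"
      using assms(4) by (auto simp: of_bool_def)
  qed (use assms in auto)
  also have "\<dots> = exp (- \<theta> * B) * (\<Prod>l\<in>I. \<Sum>j\<in>J. \<rho> l j * exp (\<theta> * f j))"
    unfolding expect_cmult using assms by (subst expect_prod) auto
  also have "\<dots> \<le> exp (- \<theta> * B) * (\<Prod>l\<in>I. exp \<kappa>)"
    using assms by (intro mult_left_mono prod_mono) (auto intro!: sum_nonneg)
  also have "\<dots> = exp (\<kappa> * real (card I) - \<theta> * B)"
    by (simp add: exp_of_nat_mult[symmetric] mult_ac flip: exp_add)
  finally show ?thesis .
qed

text \<open>Lindeberg's replacement scheme: pass from \<open>\<mu>\<close> to \<open>\<nu>\<close>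
  one coordinate at a time and telescope. A step costs \<open>\<eta>\<close> if the other
  coordinates have \<open>f\<close>-sum at most \<open>B\<close>, and at most 2 otherwise, an event
  controlled by Chernoff's bound.\<close>

lemma expect_replacement:
  fixes \<mu> \<nu> :: "'j \<Rightarrow> real"
  assumes J: "finite J" and pos: "\<And>j. j \<in> J \<Longrightarrow> \<mu> j \<ge> 0 \<and> \<nu> j \<ge> 0"
    and one: "(\<Sum>j\<in>J. \<mu> j) = 1" "(\<Sum>j\<in>J. \<nu> j) = 1"
    and F: "\<And>u. \<bar>F u\<bar> \<le> 1"
    and "\<theta> \<ge> 0" "\<kappa> \<ge> 0" "(\<Sum>j\<in>J. \<mu> j * exp (\<theta> * f j)) \<le> exp \<kappa>" "(\<Sum>j\<in>J. \<nu> j * exp (\<theta> * f j)) \<le> exp \<kappa>"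
    and good: "\<And>i v. i < N \<Longrightarrow> v \<in> PiE ({..<N} - {i}) (\<lambda>_. J) \<Longrightarrow> (\<Sum>l\<in>{..<N} - {i}. f (v l)) \<le> B \<Longrightarrow>
       \<bar>\<Sum>j\<in>J. (\<mu> j - \<nu> j) * F (v(i := j))\<bar> \<le> \<eta>"
    and "\<eta> \<ge> 0"
  shows "\<bar>expect {..<N} J (\<lambda>_. \<mu>) F - expect {..<N} J (\<lambda>_. \<nu>) F\<bar> \<le>
     real N * (\<eta> + 2 * exp (\<kappa> * real N - \<theta> * B))"
proof -
  \<comment> \<open>The first \<open>i\<close> coordinates are already replaced, so consecutive
    hybrids differ only in the law of coordinate \<open>i\<close>.\<close>
  define hyb where "hyb i l = (if l < i then \<nu> else \<mu>)" for i l :: nat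
  define \<beta> where "\<beta> = exp (\<kappa> * real N - \<theta> * B)"
  have step: "\<bar>expect {..<N} J (hyb i) F - expect {..<N} J (hyb (Suc i)) F\<bar> \<le> \<eta> + 2 * \<beta>" if i: "i < N" for i
  proof -
    let ?I = "{..<N} - {i}"
    have I: "{..<N} = insert i ?I" using i by auto
    have hyb_pos: "hyb i l j \<ge> 0" if "j \<in> J" for l j using pos that by (simp add: hyb_def)
    have "expect {..<N} J (hyb (Suc i)) F = expect ?I J (hyb (Suc i)) (\<lambda>v. \<Sum>j\<in>J. \<nu> j * F (v(i := j)))"
      by (subst I, subst expect_insert) (use J in \<open>auto simp: hyb_def\<close>)
    also have "\<dots> = expect ?I J (hyb i) (\<lambda>v. \<Sum>j\<in>J. \<nu> j * F (v(i := j)))"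
      unfolding expect_def
      by (intro sum.cong arg_cong2[of _ _ _ _ "(*)"] prod.cong refl) (auto simp: hyb_def)
    finally have Suc: "expect {..<N} J (hyb (Suc i)) F = \<dots>" .
    have "expect {..<N} J (hyb i) F = expect ?I J (hyb i) (\<lambda>v. \<Sum>j\<in>J. \<mu> j * F (v(i := j)))"
      by (subst I, subst expect_insert) (use J in \<open>auto simp: hyb_def\<close>)
    then have "expect {..<N} J (hyb i) F - expect {..<N} J (hyb (Suc i)) F =
        expect ?I J (hyb i) (\<lambda>v. \<Sum>j\<in>J. (\<mu> j - \<nu> j) * F (v(i := j)))"
      unfolding Suc by (simp add: expect_def left_diff_distrib sum_subtractf right_diff_distrib)
    also have "\<bar>\<dots>\<bar> \<le> expect ?I J (hyb i) (\<lambda>v. \<bar>\<Sum>j\<in>J. (\<mu> j - \<nu> j) * F (v(i := j))\<bar>)"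
      unfolding expect_def
      by (rule order.trans[OF sum_abs], rule sum_mono)
        (use hyb_pos in \<open>auto simp: abs_mult abs_prod intro!: mult_mono prod_nonneg prod_mono dest: PiE_mem\<close>)
    also have "\<dots> \<le> expect ?I J (hyb i) (\<lambda>v. \<eta> + 2 * of_bool (B < (\<Sum>l\<in>?I. f (v l))))"
    proof (rule expect_mono)
      fix v assume v: "v \<in> PiE ?I (\<lambda>_. J)"
      have "\<bar>\<Sum>j\<in>J. (\<mu> j - \<nu> j) * F (v(i := j))\<bar> \<le> (\<Sum>j\<in>J. \<bar>\<mu> j - \<nu> j\<bar> * \<bar>F (v(i := j))\<bar>)"
        by (rule order.trans[OF sum_abs]) (simp add: abs_mult)
      also have "\<dots> \<le> (\<Sum>j\<in>J. (\<mu> j + \<nu> j) * 1)"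
        by (intro sum_mono mult_mono F) (use pos in \<open>auto simp: abs_le_iff add_nonneg_nonneg add_increasing\<close>)
      also have "\<dots> = 2" by (simp add: sum.distrib one)
      finally show "\<bar>\<Sum>j\<in>J. (\<mu> j - \<nu> j) * F (v(i := j))\<bar> \<le> \<eta> + 2 * of_bool (B < (\<Sum>l\<in>?I. f (v l)))"
        using good[OF i v] \<open>\<eta> \<ge> 0\<close> by (cases "B < (\<Sum>l\<in>?I. f (v l))") auto
    qed (use hyb_pos in auto)
    also have "\<dots> = \<eta> + 2 * expect ?I J (hyb i) (\<lambda>v. of_bool (B < (\<Sum>l\<in>?I. f (v l))))"
      unfolding expect_add expect_cmult
      by (subst expect_const) (use J one in \<open>auto simp: hyb_def\<close>)
    also have "\<dots> \<le> \<eta> + 2 * exp (\<kappa> * real (card ?I) - \<theta> * B)"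
      by (intro add_left_mono mult_left_mono expect_tail)
        (use J hyb_pos assms in \<open>auto simp: hyb_def\<close>)
    also have "\<dots> \<le> \<eta> + 2 * \<beta>"
      unfolding \<beta>_def using i \<open>\<kappa> \<ge> 0\<close> by (auto intro!: mult_left_mono)
    finally show ?thesis .
  qed
  have "\<bar>expect {..<N} J (hyb 0) F - expect {..<N} J (hyb n) F\<bar> \<le> real n * (\<eta> + 2 * \<beta>)" if "n \<le> N" for n
    using that
  proof (induction n)
    case (Suc n)
    then show ?case using step[of n] by (simp add: algebra_simps)
  qed simp
  from this[of N] have "\<bar>expect {..<N} J (hyb 0) F - expect {..<N} J (hyb N) F\<bar> \<le> real N * (\<eta> + 2 * \<beta>)" by simp
  moreover have "expect {..<N} J (hyb 0) F = expect {..<N} J (\<lambda>_. \<mu>) F"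
    by (simp add: expect_def hyb_def)
  moreover have "expect {..<N} J (hyb N) F = expect {..<N} J (\<lambda>_. \<nu>) F"
    by (simp add: expect_def hyb_def)
  ultimately show ?thesis unfolding \<beta>_def by simp
qed

subsection \<open>Indistinguishability of the two priors\<close>

text \<open>Normalise the weights on even and on odd indices separately; the moments agree because
  the alternating sums vanish. The exponential moments are taken at the reciprocal of the upper
  bound for the nodes.\<close>

lemma matching_moment_priors:
  assumes m: "m > 0"
  obtains \<mu> \<nu> :: "nat \<Rightarrow> real" where
    "\<And>j. \<mu> j \<ge> 0" "\<And>j. \<nu> j \<ge> 0" "(\<Sum>j<8*m. \<mu> j) = 1" "(\<Sum>j<8*m. \<nu> j) = 1"
    "\<And>a. a < 2 * m \<Longrightarrow> (\<Sum>j<8*m. (\<mu> j - \<nu> j) * node m j ^ a) = 0"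
    "(\<Sum>j<8*m. \<bar>\<mu> j - \<nu> j\<bar>) = 2" "\<mu> 0 \<ge> 1 / 4" "\<nu> 0 = 0"
    "(\<Sum>j<8*m. \<mu> j * exp (1 / (16 * (real m)\<^sup>2) * node m j)) \<le> exp (16 / (real m)\<^sup>2)"
    "(\<Sum>j<8*m. \<nu> j * exp (1 / (16 * (real m)\<^sup>2) * node m j)) \<le> exp (16 / (real m)\<^sup>2)"
proof -
  define S where "S = (\<Sum>j<8*m. of_bool (even j) * weight m j)"
  define \<mu> where "\<mu> j = of_bool (even j) * weight m j / S" for j
  define \<nu> where "\<nu> j = of_bool (odd j) * weight m j / S" for j
  \<comment> \<open>The vanishing alternating sum for \<open>a = 0\<close>: both halves have the
    same normalising constant.\<close>
  have S_odd: "(\<Sum>j<8*m. of_bool (odd j) * weight m j) = S"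
  proof -
    have "(\<Sum>j<8*m. (-1) ^ j * weight m j) = 0"
      using sum_alternating_weight_node_power[of m 0] m by simp
    moreover have "(-1) ^ j * weight m j = of_bool (even j) * weight m j - of_bool (odd j) * weight m j" for j
      by (cases "even j") auto
    ultimately show ?thesis by (simp add: sum_subtractf S_def)
  qed
  have S_ge: "S \<ge> 1"
  proof -
    have "of_bool (even (0::nat)) * weight m 0 \<le> S"
      unfolding S_def
      using m by (intro member_le_sum[of 0 "{..<8*m}" "\<lambda>j. of_bool (even j) * weight m j"]) auto
    then show ?thesis using weight_0[OF m] by simp
  qed
  \<comment> \<open>Both halves sum to \<open>S\<close>, and together they are at most the Parseval
    sum 8. Hence the atom of \<open>\<mu>\<close> at 0 is at least 1/4.\<close>
  have S_le: "S \<le> 4"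
  proof -
    have "2 * S = (\<Sum>j<8*m. of_bool (even j) * weight m j) + (\<Sum>j<8*m. of_bool (odd j) * weight m j)"
      unfolding S_odd by (simp add: S_def)
    also have "\<dots> = (\<Sum>j<8*m. weight m j)"
      unfolding sum.distrib[symmetric] by (intro sum.cong) auto
    also have "\<dots> \<le> (\<Sum>j<8*m. fejer m (uroot m j))" by (intro sum_mono weight_le_fejer)
    finally show ?thesis using sum_fejer[OF m] by simp
  qed
  have nonneg: "\<mu> j \<ge> 0" "\<nu> j \<ge> 0" for j
    using S_ge by (auto simp: \<mu>_def \<nu>_def)
  have sum_one: "(\<Sum>j<8*m. \<mu> j) = 1" "(\<Sum>j<8*m. \<nu> j) = 1"
    using S_ge S_odd by (simp_all add: \<mu>_def \<nu>_def S_def flip: sum_divide_distrib)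
  have moments: "(\<Sum>j<8*m. (\<mu> j - \<nu> j) * node m j ^ a) = 0" if a: "a < 2 * m" for a
  proof -
    have "(\<mu> j - \<nu> j) * node m j ^ a = (-1) ^ j * weight m j * node m j ^ a / S" for j
      by (simp add: \<mu>_def \<nu>_def)
    then show ?thesis
      using sum_alternating_weight_node_power[OF m a] by (simp flip: sum_divide_distrib)
  qed
  \<comment> \<open>The supports are disjoint, one even and one odd.\<close>
  have "\<bar>\<mu> j - \<nu> j\<bar> = \<mu> j + \<nu> j" for j
    using S_ge by (auto simp: \<mu>_def \<nu>_def)
  then have diff: "(\<Sum>j<8*m. \<bar>\<mu> j - \<nu> j\<bar>) = 2" by (simp add: sum.distrib sum_one)
  have le_weight: "\<mu> j \<le> weight m j" "\<nu> j \<le> weight m j" for j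
    using S_ge mult_left_mono[OF S_ge, of "weight m j"] by (auto simp: \<mu>_def \<nu>_def divide_le_eq)
  \<comment> \<open>The exponent is at most 1, where exp x \<le> 1 + 2 x, and the mean of the nodes
    is at most 128; 2 * 128 / 16 = 16.\<close>
  have mgf: "(\<Sum>j<8*m. \<rho> j * exp (1 / (16 * (real m)\<^sup>2) * node m j)) \<le> exp (16 / (real m)\<^sup>2)"
    if \<rho>: "\<And>j. \<rho> j \<ge> 0" "\<And>j. \<rho> j \<le> weight m j" "(\<Sum>j<8*m. \<rho> j) = 1" for \<rho>
  proof -
    let ?l = "16 * (real m)\<^sup>2"
    have l: "?l > 0" using m by simp
    have "exp (1 / ?l * node m j) \<le> 1 + 2 * node m j / ?l" for j
    proof -
      have "node m j / ?l \<le> 1" using node_le[of m j] l divide_le_eq_1_pos by blast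
      then have "exp (node m j / ?l) \<le> 1 + (node m j / ?l) + (node m j / ?l)\<^sup>2"
        using l by (intro exp_bound) auto
      also have "(node m j / ?l)\<^sup>2 \<le> node m j / ?l"
        using power_decreasing[of 1 2 "node m j / ?l"] \<open>node m j / ?l \<le> 1\<close> l by simp
      finally show ?thesis by simp
    qed
    then have "(\<Sum>j<8*m. \<rho> j * exp (1 / ?l * node m j)) \<le> (\<Sum>j<8*m. \<rho> j * (1 + 2 * node m j / ?l))"
      using \<rho> by (intro sum_mono mult_left_mono) auto
    also have "\<dots> = 1 + 2 / ?l * (\<Sum>j<8*m. \<rho> j * node m j)"
      using \<rho>(3) by (simp add: distrib_left sum.distrib sum_distrib_left mult_ac)
    also have "\<dots> \<le> 1 + 2 / ?l * (\<Sum>j<8*m. weight m j * node m j)"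
      using \<rho> l by (intro add_left_mono mult_left_mono sum_mono mult_right_mono) auto
    also have "\<dots> \<le> 1 + 2 / ?l * 128"
      using l by (intro add_left_mono mult_left_mono sum_weight_node_le[OF m]) auto
    also have "\<dots> = 1 + 16 / (real m)\<^sup>2" by (simp add: field_simps)
    also have "\<dots> \<le> exp (16 / (real m)\<^sup>2)" by (rule exp_ge_add_one_self)
    finally show ?thesis .
  qed
  have "\<mu> 0 \<ge> 1 / 4" "\<nu> 0 = 0"
    using S_le S_ge weight_0[OF m] by (simp_all add: \<mu>_def \<nu>_def divide_simps)
  then show ?thesis
    using that[OF nonneg sum_one moments diff _ _ mgf[OF nonneg(1) le_weight(1) sum_one(1)]
        mgf[OF nonneg(2) le_weight(2) sum_one(2)]] by blast
qed

text \<open>Average \<open>accept\<close> over masses \<open>node m (u i) / W\<close> with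
  independent \<open>u i\<close> drawn from either prior. The first prior mostly yields at most
  \<open>k\<close> elements of positive mass, the second gives every element mass at least
  \<open>1 / (512 * N)\<close>. The left side is the gap forced on the two averages, the right side
  bounds it by the replacement error.\<close>

lemma pair_sample_lower_bound:
  fixes N k t :: nat and acc :: "(nat \<Rightarrow> nat) \<Rightarrow> real"
  assumes m: "m > 0"
    and N: "N > 0" "real k \<ge> 7 / 8 * real N" and t: "t * m \<le> 2 * N"
    and acc: "\<And>s. 0 \<le> acc s \<and> acc s \<le> 1"
    and yes: "\<And>y. (\<And>i. i < N \<Longrightarrow> y i \<ge> 0) \<Longrightarrow> (\<Sum>i<N. y i) \<le> 1 \<Longrightarrow> card {i. i < N \<and> y i > 0} \<le> k \<Longrightarrow>
      accept t acc N y \<ge> 2 / 3"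
    and no: "\<And>y. (\<And>i. i < N \<Longrightarrow> y i \<ge> 1 / (512 * real N)) \<Longrightarrow> (\<Sum>i<N. y i) \<le> 1 \<Longrightarrow>
      accept t acc N y \<le> 1 / 3"
  shows "2 / 3 * (1 - exp (1 - 16 * real N / (real m)\<^sup>2) - exp (real N * (ln (7/4) - 7/8 * ln 2))) - 1 / 3
     \<le> real N * (2 * exp (- 2 * real m) + 2 * exp (1 - 16 * real N / (real m)\<^sup>2))"
proof -
  obtain \<mu> \<nu> :: "nat \<Rightarrow> real" where nonneg: "\<And>j. \<mu> j \<ge> 0" "\<And>j. \<nu> j \<ge> 0"
    and sum_one: "(\<Sum>j<8*m. \<mu> j) = 1" "(\<Sum>j<8*m. \<nu> j) = 1"
    and moments: "\<And>a. a < 2 * m \<Longrightarrow> (\<Sum>j<8*m. (\<mu> j - \<nu> j) * node m j ^ a) = 0"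
    and dist: "(\<Sum>j<8*m. \<bar>\<mu> j - \<nu> j\<bar>) = 2" and atom: "\<mu> 0 \<ge> 1 / 4" "\<nu> 0 = 0"
    and mgf: "(\<Sum>j<8*m. \<mu> j * exp (1 / (16 * (real m)\<^sup>2) * node m j)) \<le> exp (16 / (real m)\<^sup>2)"
      "(\<Sum>j<8*m. \<nu> j * exp (1 / (16 * (real m)\<^sup>2) * node m j)) \<le> exp (16 / (real m)\<^sup>2)"
    using matching_moment_priors[OF m] by blast
  \<comment> \<open>Exponential moment of the indicator of a nonzero node at
    \<open>\<theta> = ln 2\<close>, equal to \<open>2 - \<mu> 0\<close>; it feeds the Chernoff bound
    for more than \<open>7/8 * N\<close> occupied elements.\<close>
  have support_mgf: "(\<Sum>j<8*m. \<mu> j * exp (ln 2 * of_bool (j > 0))) \<le> exp (ln (7/4))"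
  proof -
    have "\<mu> j * exp (ln 2 * of_bool (j > 0)) = 2 * \<mu> j - (if j = 0 then \<mu> 0 else 0)" for j
      by auto
    then have "(\<Sum>j<8*m. \<mu> j * exp (ln 2 * of_bool (j > 0))) = 2 - \<mu> 0"
      using m by (simp add: sum_subtractf sum_one flip: sum_distrib_left)
    then show ?thesis using atom by simp
  qed
  \<comment> \<open>\<open>W\<close> is four times the bound \<open>128 * N\<close> on the expected
    sum of the nodes, so exceeding it is exponentially unlikely. \<open>M\<close> bounds a single
    node.\<close>
  define W where "W = 512 * real N"
  define M where "M = 16 * (real m)\<^sup>2"
  define J where "J = {..<8*m}"
  define Y where "Y u i = node m (u i) / W" for u :: "nat \<Rightarrow> nat" and i
  \<comment> \<open>Draws of total mass above 1 define no distribution. The value 0 respects the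
    upper bound needed for the second prior and costs only a tail probability under the
    first.\<close>
  define A where "A u = (if (\<Sum>i<N. Y u i) \<le> 1 then accept t acc N (Y u) else 0)" for u
  have W: "W > 0" and M0: "M > 0" using N m by (auto simp: W_def M_def)
  have Y_nonneg: "Y u i \<ge> 0" for u i using W by (simp add: Y_def)
  have A_nonneg: "A u \<ge> 0" and A_le: "A u \<le> 1" for u
    using accept_bounds[of N "Y u" acc t] Y_nonneg acc by (auto simp: A_def)
  have sumY: "(\<Sum>i<N. Y u i) \<le> 1 \<longleftrightarrow> (\<Sum>i<N. node m (u i)) \<le> W" for u
    using W by (simp add: Y_def sum_divide_distrib[symmetric])
  have exponent: "16 / (real m)\<^sup>2 * real N - 1 / M * (W - M) = 1 - 16 * real N / (real m)\<^sup>2"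
    using m by (simp add: M_def W_def field_simps)
  \<comment> \<open>The threshold \<open>W - M\<close> leaves room for coordinate \<open>i\<close>
    to take any value without the total exceeding \<open>W\<close>, so \<open>A\<close> is given by
    \<open>accept\<close> for all \<open>j\<close>.\<close>
  have diff: "\<bar>expect {..<N} J (\<lambda>_. \<mu>) A - expect {..<N} J (\<lambda>_. \<nu>) A\<bar> \<le>
     real N * (2 * exp (- 2 * real m) + 2 * exp (16 / (real m)\<^sup>2 * real N - 1 / M * (W - M)))"
  proof (rule expect_replacement[where f = "node m"])
    fix i v assume i: "i < N" and v: "v \<in> PiE ({..<N} - {i}) (\<lambda>_. J)"
      and good: "(\<Sum>l\<in>{..<N} - {i}. node m (v l)) \<le> W - M"
    have Yi: "Y (v(i := j)) = (Y v)(i := node m j / W)" for j by (auto simp: Y_def)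
    have "A (v(i := j)) = accept t acc N ((Y v)(i := node m j / W))" for j
    proof -
      have "(\<Sum>l<N. node m ((v(i := j)) l)) = node m j + (\<Sum>l\<in>{..<N} - {i}. node m (v l))"
        using i by (subst sum.remove[of _ i]) auto
      also have "\<dots> \<le> W" using good node_le[of m j] by (simp add: M_def)
      finally have "(\<Sum>l<N. Y (v(i := j)) l) \<le> 1" unfolding sumY .
      then have "A (v(i := j)) = accept t acc N (Y (v(i := j)))" by (simp only: A_def if_True)
      then show ?thesis by (simp only: Yi)
    qed
    then have "\<bar>\<Sum>j\<in>J. (\<mu> j - \<nu> j) * A (v(i := j))\<bar> =
       \<bar>\<Sum>j\<in>J. (\<mu> j - \<nu> j) * accept t acc N ((Y v)(i := node m j / W))\<bar>" by simp
    \<comment> \<open>Take \<open>z = 16 * (M / W)\<close>: the moments gain 16^(-2m) \<le>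
      exp(-4m), while (1 + 2z)^t \<le> exp(t m^2 / N) \<le> exp(2m) because
      \<open>t * m \<le> 2 * N\<close>.\<close>
    also have "\<dots> \<le> (\<Sum>j\<in>J. \<bar>\<mu> j - \<nu> j\<bar>) * (M / W / (16 * (M / W))) ^ (2 * m) *
        (1 + 2 * (16 * (M / W))) ^ t"
    proof (rule accept_change_coordinate)
      fix a assume "a < 2 * m"
      then have "(\<Sum>j<8*m. (\<mu> j - \<nu> j) * node m j ^ a) / W ^ a = 0"
        by (simp add: moments)
      then show "(\<Sum>j\<in>J. (\<mu> j - \<nu> j) * (node m j / W) ^ a) = 0"
        by (simp add: J_def power_divide sum_divide_distrib)
    next
      show "0 \<le> node m j / W \<and> node m j / W \<le> M / W" for j
        using W node_le[of m j] by (auto simp: M_def intro: divide_right_mono)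
      have "(\<Sum>l\<in>{..<N} - {i}. Y v l) \<le> (W - M) / W"
        using good W by (simp add: Y_def sum_divide_distrib[symmetric] divide_right_mono)
      also have "\<dots> \<le> 1" using W M0 by simp
      finally show "(\<Sum>l\<in>{..<N} - {i}. Y v l) \<le> 1" .
    qed (use W M0 i Y_nonneg acc in \<open>auto simp: J_def intro: divide_right_mono\<close>)
    also have "\<dots> = 2 * (1 / 16) ^ (2 * m) * (1 + 32 * (M / W)) ^ t"
      unfolding J_def dist using W M0 by simp
    also have "\<dots> \<le> 2 * exp (- (4 * real m)) * exp (2 * real m)"
    proof (intro mult_mono mult_left_mono)
      have "exp (2::real) \<le> 16"
      proof -
        have "exp (2::real) = exp 1 * exp 1" by (simp flip: exp_add)
        also have "\<dots> \<le> 3 * 3" by (intro mult_mono exp_le) auto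
        finally show ?thesis by simp
      qed
      then have "(1 / 16 :: real) \<le> exp (- 2)" by (simp add: exp_minus field_simps)
      then have "(1 / 16 :: real) ^ (2 * m) \<le> exp (- 2) ^ (2 * m)" by (intro power_mono) auto
      also have "\<dots> = exp (- (4 * real m))" by (simp flip: exp_of_nat_mult)
      finally show "(1 / 16 :: real) ^ (2 * m) \<le> exp (- (4 * real m))" .
      have "(1 + 32 * (M / W)) ^ t \<le> exp (32 * (M / W)) ^ t"
        using W M0 by (intro power_mono exp_ge_add_one_self) auto
      also have "\<dots> = exp (real m * (real (t * m) / real N))"
        unfolding M_def W_def using N by (simp add: power2_eq_square field_simps flip: exp_of_nat_mult)
      also have "\<dots> \<le> exp (real m * 2)"
      proof -
        have "real (t * m) \<le> 2 * real N" using of_nat_mono[OF t, where 'a = real] by simp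
        then have "real (t * m) / real N \<le> 2" using N by (simp add: field_simps)
        then have "real m * (real (t * m) / real N) \<le> real m * 2" by (intro mult_left_mono) auto
        then show ?thesis by (simp only: exp_le_cancel_iff)
      qed
      finally show "(1 + 32 * (M / W)) ^ t \<le> exp (2 * real m)" by (simp add: mult.commute)
    qed (use W M0 in auto)
    also have "\<dots> = 2 * exp (- 2 * real m)" by (simp flip: exp_add)
    finally show "\<bar>\<Sum>j\<in>J. (\<mu> j - \<nu> j) * A (v(i := j))\<bar> \<le> 2 * exp (- 2 * real m)" .
  next
    show "\<bar>A u\<bar> \<le> 1" for u using A_nonneg[of u] A_le[of u] by simp
    show "(\<Sum>j\<in>J. \<mu> j * exp (1 / M * node m j)) \<le> exp (16 / (real m)\<^sup>2)"
      "(\<Sum>j\<in>J. \<nu> j * exp (1 / M * node m j)) \<le> exp (16 / (real m)\<^sup>2)"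
      unfolding J_def M_def
      by (fact mgf)+
  qed (use M0 in \<open>auto simp: J_def nonneg sum_one\<close>)
  \<comment> \<open>Draws with a zero index have weight 0 since \<open>\<nu> 0 = 0\<close>; in all
    others every node is at least 1.\<close>
  have no_le: "expect {..<N} J (\<lambda>_. \<nu>) A \<le> 1 / 3"
  proof -
    have "expect {..<N} J (\<lambda>_. \<nu>) A \<le> expect {..<N} J (\<lambda>_. \<nu>) (\<lambda>_. 1 / 3)"
      unfolding expect_def
    proof (rule sum_mono)
      fix u assume u: "u \<in> PiE {..<N} (\<lambda>_. J)"
      show "(\<Prod>l<N. \<nu> (u l)) * A u \<le> (\<Prod>l<N. \<nu> (u l)) * (1 / 3)"
      proof (cases "\<exists>l<N. u l = 0")
        case True
        then obtain l where "l < N" "\<nu> (u l) = 0" by (auto simp: atom)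
        then have "(\<Prod>l<N. \<nu> (u l)) = 0" by auto
        then show ?thesis by (simp only: mult_zero_left order_refl)
      next
        case False
        have "Y u i \<ge> 1 / (512 * real N)" if "i < N" for i
        proof -
          have "u i \<in> J" using u that by auto
          then have "node m (u i) \<ge> 1" using False that by (intro node_ge_1) (auto simp: J_def)
          then show ?thesis using N by (simp add: Y_def W_def divide_right_mono)
        qed
        then have "A u \<le> 1 / 3" using no[of "Y u"] by (auto simp: A_def)
        then show ?thesis by (intro mult_left_mono prod_nonneg) (auto simp: nonneg)
      qed
    qed
    also have "\<dots> = 1 / 3" by (rule expect_const) (auto simp: J_def sum_one)
    finally show ?thesis .
  qed
  \<comment> \<open>The number of elements with a nonzero index. Two tails are removed by a union
    bound: total mass too large and too many occupied elements.\<close>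
  define C where "C u = (\<Sum>i<N. of_bool (u i > 0) :: real)" for u :: "nat \<Rightarrow> nat"
  have "2 / 3 * (1 - exp (1 - 16 * real N / (real m)\<^sup>2) - exp (real N * (ln (7/4) - 7/8 * ln 2))) \<le>
      2 / 3 * expect {..<N} J (\<lambda>_. \<mu>) (\<lambda>u. 1 + (- 1) * of_bool (W - M < (\<Sum>i<N. node m (u i))) +
      (- 1) * of_bool (7/8 * real N < C u))"
  proof -
    have "expect {..<N} J (\<lambda>_. \<mu>) (\<lambda>u. of_bool (W - M < (\<Sum>i<N. node m (u i)))) \<le>
       exp (16 / (real m)\<^sup>2 * real (card {..<N}) - 1 / M * (W - M))"
      by (rule expect_tail)
        (use M0 nonneg mgf in \<open>auto simp: J_def M_def\<close>)
    then have "expect {..<N} J (\<lambda>_. \<mu>) (\<lambda>u. of_bool (W - M < (\<Sum>i<N. node m (u i)))) \<le>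
       exp (1 - 16 * real N / (real m)\<^sup>2)"
      unfolding card_lessThan exponent .
    moreover have "expect {..<N} J (\<lambda>_. \<mu>) (\<lambda>u. of_bool (7/8 * real N < C u)) \<le>
       exp (ln (7/4) * real (card {..<N}) - ln 2 * (7/8 * real N))"
      unfolding C_def
      by (rule expect_tail) (use nonneg support_mgf in \<open>auto simp: J_def\<close>)
    moreover have "ln (7/4) * real (card {..<N}) - ln 2 * (7/8 * real N) = real N * (ln (7/4) - 7/8 * ln 2)"
      by (simp add: algebra_simps)
    moreover have "expect {..<N} J (\<lambda>_. \<mu>) (\<lambda>_. 1) = 1"
      by (rule expect_const) (auto simp: J_def sum_one)
    ultimately show ?thesis
      unfolding expect_add expect_cmult by simp
  qed
  also have "\<dots> \<le> expect {..<N} J (\<lambda>_. \<mu>) A"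
    unfolding expect_cmult[symmetric]
  proof (rule expect_mono)
    fix u
    show "2 / 3 * (1 + (- 1) * of_bool (W - M < (\<Sum>i<N. node m (u i))) + (- 1) * of_bool (7/8 * real N < C u)) \<le> A u"
    proof (cases "(\<Sum>i<N. node m (u i)) \<le> W - M \<and> C u \<le> 7/8 * real N")
      case True
      have "{i. i < N \<and> Y u i > 0} \<subseteq> {i \<in> {..<N}. u i > 0}"
        using W by (auto simp: Y_def intro!: gr0I)
      then have "card {i. i < N \<and> Y u i > 0} \<le> card {i \<in> {..<N}. u i > 0}" by (intro card_mono) auto
      also have "real \<dots> = C u" unfolding C_def by (simp add: Int_def)
      also have "\<dots> \<le> real k" using True N by simp
      finally have "card {i. i < N \<and> Y u i > 0} \<le> k" by simp
      moreover have s: "(\<Sum>i<N. Y u i) \<le> 1" using True M0 by (simp add: sumY)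
      ultimately show ?thesis using yes[of "Y u"] Y_nonneg by (auto simp: A_def of_bool_def)
    qed (use A_nonneg[of u] in \<open>auto simp: of_bool_def\<close>)
  qed (auto simp: nonneg)
  finally show ?thesis using diff no_le unfolding exponent by linarith
qed

subsection \<open>From testers to support size\<close>

definition pair_dist :: "nat \<Rightarrow> (nat \<Rightarrow> real) \<Rightarrow> real measure" where
  "pair_dist N y = distr (point_measure {..2 * N} (\<lambda>p. ennreal (pair_mass N y p))) borel real"

text \<open>With a set as parameter this covers both the full labelling and its restriction to
  elements of positive mass.\<close>

definition pair_label :: "nat set \<Rightarrow> real \<Rightarrow> bool" where
  "pair_label S x \<longleftrightarrow> (\<exists>i\<in>S. x = real (2 * i))"

lemma pair_label_interval_union:
  assumes "finite S" "card S \<le> k"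
  shows "pair_label S \<in> interval_unions k"
proof -
  obtain g where g: "bij_betw g {..<card S} S"
    using ex_bij_betw_nat_finite[OF assms(1)] by (auto simp: atLeast0LessThan)
  \<comment> \<open>One-point intervals at the points labelled 1; surplus indices get the empty
    interval [1, 0].\<close>
  define a :: "nat \<Rightarrow> ereal" where "a i = (if i < card S then ereal (real (2 * g i)) else 1)" for i
  define b :: "nat \<Rightarrow> ereal" where "b i = (if i < card S then ereal (real (2 * g i)) else 0)" for i
  have "pair_label S x \<longleftrightarrow> (\<exists>i<k. a i \<le> ereal x \<and> ereal x \<le> b i)" for x
  proof
    assume "pair_label S x"
    then obtain i' where i': "i' \<in> S" "x = real (2 * i')" unfolding pair_label_def by blast
    then have "i' \<in> g ` {..<card S}" using g by (simp add: bij_betw_def)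
    then obtain i where "i < card S" "x = real (2 * g i)" using i' by blast
    then show "\<exists>i<k. a i \<le> ereal x \<and> ereal x \<le> b i"
      using assms(2) by (intro exI[of _ i]) (auto simp: a_def b_def)
  next
    assume "\<exists>i<k. a i \<le> ereal x \<and> ereal x \<le> b i"
    then obtain i where i: "a i \<le> ereal x" "ereal x \<le> b i" by blast
    have "i < card S"
    proof (rule ccontr)
      assume "\<not> i < card S"
      then have "(1::ereal) \<le> ereal x" "ereal x \<le> 0" using i by (auto simp: a_def b_def)
      then show False by (simp add: one_ereal_def zero_ereal_def)
    qed
    then have "x = real (2 * g i)" "g i \<in> S" using i g by (auto simp: a_def b_def bij_betw_def)
    then show "pair_label S x" unfolding pair_label_def by blast
  qed
  then show ?thesis unfolding interval_unions_def by blast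
qed

lemma interval_union_measurable:
  assumes "h \<in> interval_unions k"
  shows "h \<in> borel \<rightarrow>\<^sub>M count_space UNIV"
proof -
  obtain a b :: "nat \<Rightarrow> ereal" where "\<And>x. h x \<longleftrightarrow> (\<exists>i<k. a i \<le> ereal x \<and> ereal x \<le> b i)"
    using assms unfolding interval_unions_def by blast
  then have "h = (\<lambda>x. \<exists>i<k. a i \<le> ereal x \<and> ereal x \<le> b i)" by (intro ext)
  then show ?thesis by simp
qed

text \<open>An interval containing \<open>2 * i\<close> and \<open>2 * i'\<close> with \<open>i < i'\<close> also contains \<open>2 * i + 1\<close>.\<close>

lemma interval_union_card_drops:
  assumes "h \<in> interval_unions k"
  shows "card {i. i < N \<and> h (real (2 * i)) \<and> \<not> h (real (2 * i + 1))} \<le> k"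
proof -
  obtain a b :: "nat \<Rightarrow> ereal" where h: "\<And>x. h x \<longleftrightarrow> (\<exists>i<k. a i \<le> ereal x \<and> ereal x \<le> b i)"
    using assms unfolding interval_unions_def by blast
  let ?G = "{i. i < N \<and> h (real (2 * i)) \<and> \<not> h (real (2 * i + 1))}"
  define J where "J i = (SOME j. j < k \<and> a j \<le> ereal (real (2 * i)) \<and> ereal (real (2 * i)) \<le> b j)" for i
  have J: "J i < k" "a (J i) \<le> ereal (real (2 * i))" "ereal (real (2 * i)) \<le> b (J i)" if "i \<in> ?G" for i
  proof -
    have "\<exists>j. j < k \<and> a j \<le> ereal (real (2 * i)) \<and> ereal (real (2 * i)) \<le> b j"
      using that h by auto
    from someI_ex[OF this] show "J i < k" "a (J i) \<le> ereal (real (2 * i))" "ereal (real (2 * i)) \<le> b (J i)"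
      unfolding J_def by auto
  qed
  have neq: "J i \<noteq> J i'" if "i \<in> ?G" "i' \<in> ?G" "i < i'" for i i'
  proof
    assume eq: "J i = J i'"
    have "ereal (real (2 * i)) \<le> ereal (real (2 * i + 1))" "ereal (real (2 * i + 1)) \<le> ereal (real (2 * i'))"
      using that(3) by auto
    then have "a (J i) \<le> ereal (real (2 * i + 1))" "ereal (real (2 * i + 1)) \<le> b (J i)"
      unfolding eq using J(2)[OF that(1), unfolded eq] J(3)[OF that(2)] by (blast intro: order.trans)+
    then have "h (real (2 * i + 1))" using h J(1)[OF that(1)] by blast
    then show False using that(1) by simp
  qed
  have "inj_on J ?G"
    by (rule linorder_inj_onI) (use neq in auto)
  then show ?thesis using card_inj_on_le[of J ?G "{..<k}"] J(1) by auto
qed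

section \<open>Distance to the interval class under the pair distribution\<close>

lemma prob_space_pair_dist:
  assumes y: "\<And>i. i < N \<Longrightarrow> y i \<ge> 0" "(\<Sum>i<N. y i) \<le> 1"
  shows "prob_space (pair_dist N y)"
proof -
  have "(\<Sum>p\<in>{..2 * N}. ennreal (pair_mass N y p)) = ennreal (\<Sum>p\<le>2 * N. pair_mass N y p)"
    by (rule sum_ennreal) (use pair_mass_nonneg[OF y] in auto)
  then have "prob_space (point_measure {..2 * N} (\<lambda>p. ennreal (pair_mass N y p)))"
    by (intro prob_space_point_measure) (auto simp: sum_pair_mass)
  then show ?thesis unfolding pair_dist_def
    by (rule prob_space.prob_space_distr) simp
qed

lemma sets_pair_dist [simp]: "sets (pair_dist N y) = sets borel"
  by (simp add: pair_dist_def)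

lemma space_pair_dist [simp]: "space (pair_dist N y) = UNIV"
  by (simp add: pair_dist_def)

lemma measure_pair_dist:
  assumes y: "\<And>i. i < N \<Longrightarrow> y i \<ge> 0" "(\<Sum>i<N. y i) \<le> 1"
    and Q: "Q \<subseteq> {..2 * N}"
  shows "measure (pair_dist N y) (real ` Q) = (\<Sum>p\<in>Q. pair_mass N y p)"
proof -
  have "finite Q" using Q finite_subset by blast
  then have "real ` Q \<in> sets borel" by (intro borel_closed finite_imp_closed) auto
  moreover have "real -` (real ` Q) \<inter> {..2 * N} = Q" using Q by auto
  ultimately have "measure (pair_dist N y) (real ` Q) =
     measure (point_measure {..2 * N} (\<lambda>p. ennreal (pair_mass N y p))) Q"
    unfolding pair_dist_def by (subst measure_distr) (auto simp: space_point_measure)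
  also have "\<dots> = (\<Sum>p\<in>Q. pair_mass N y p)"
    using Q pair_mass_nonneg[OF y]
    by (simp add: Sigma_Algebra.measure_def emeasure_point_measure_finite sum_nonneg)
  finally show ?thesis .
qed

lemma instance_pair_pair_dist:
  assumes y: "\<And>i. i < N \<Longrightarrow> y i \<ge> 0" "(\<Sum>i<N. y i) \<le> 1"
    and S: "finite S"
  shows "instance_pair (pair_dist N y) (pair_label S)"
  using prob_space_pair_dist[OF y] interval_union_measurable[OF pair_label_interval_union[OF S order.refl]]
  by (simp add: instance_pair_def)

lemma fun_dist_pair_label_support:
  assumes y: "\<And>i. i < N \<Longrightarrow> y i \<ge> 0" "(\<Sum>i<N. y i) \<le> 1"
  shows "fun_dist (pair_dist N y) (pair_label {..<N}) (pair_label {i. i < N \<and> y i > 0}) = 0"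
proof -
  let ?S = "{i. i < N \<and> y i > 0}" and ?Z = "(\<lambda>i. 2 * i) ` {i. i < N \<and> \<not> y i > 0}"
  have "{x \<in> space (pair_dist N y). pair_label {..<N} x \<noteq> pair_label ?S x} = real ` ?Z"
    by (auto simp: pair_label_def image_iff)
  then have "fun_dist (pair_dist N y) (pair_label {..<N}) (pair_label ?S) = (\<Sum>p\<in>?Z. pair_mass N y p)"
    unfolding fun_dist_def by (simp only:) (rule measure_pair_dist[OF y], auto)
  also have "\<dots> = 0"
    using y(1) by (intro sum.neutral) (auto simp: pair_mass_def intro: antisym)
  finally show ?thesis .
qed

lemma class_dist_pair_label_eq_0:
  assumes y: "\<And>i. i < N \<Longrightarrow> y i \<ge> 0" "(\<Sum>i<N. y i) \<le> 1"
    and k: "card {i. i < N \<and> y i > 0} \<le> k"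
  shows "class_dist (pair_dist N y) (pair_label {..<N}) (interval_unions k) = 0"
proof -
  have mem: "pair_label {i. i < N \<and> y i > 0} \<in> interval_unions k"
    using k by (intro pair_label_interval_union) auto
  have "class_dist (pair_dist N y) (pair_label {..<N}) (interval_unions k) \<le>
      fun_dist (pair_dist N y) (pair_label {..<N}) (pair_label {i. i < N \<and> y i > 0})"
    unfolding class_dist_def
    by (rule cINF_lower[OF _ mem]) (auto intro!: bdd_belowI[of _ 0] simp: fun_dist_def)
  moreover have "class_dist (pair_dist N y) (pair_label {..<N}) (interval_unions k) \<ge> 0"
    unfolding class_dist_def by (rule cINF_greatest) (use mem in \<open>auto simp: fun_dist_def\<close>)
  ultimately show ?thesis by (simp add: fun_dist_pair_label_support[OF y])
qed

text \<open>A pair is labelled correctly only if \<open>h\<close> drops from 1 to 0 on it, which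
  happens at most \<open>k\<close> times. Every other pair contains an error of mass at least
  \<open>\<delta> / 2\<close>.\<close>

lemma class_dist_pair_label_ge:
  assumes y: "\<And>i. i < N \<Longrightarrow> y i \<ge> 0" "(\<Sum>i<N. y i) \<le> 1"
    and \<delta>: "\<delta> \<ge> 0" "\<And>i. i < N \<Longrightarrow> y i \<ge> \<delta>"
  shows "class_dist (pair_dist N y) (pair_label {..<N}) (interval_unions k) \<ge> (real N - real k) * \<delta> / 2"
  unfolding class_dist_def
proof (rule cINF_greatest)
  show "interval_unions k \<noteq> {}" using pair_label_interval_union[of "{}" k] by auto
next
  interpret prob_space "pair_dist N y" by (rule prob_space_pair_dist[OF y])
  fix h assume h: "h \<in> interval_unions k"
  let ?f = "pair_label {..<N}"
  let ?G = "{i. i < N \<and> h (real (2 * i)) \<and> \<not> h (real (2 * i + 1))}"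
  \<comment> \<open>A point of pair \<open>i\<close> where \<open>h\<close> errs: without a drop,
    \<open>h (2 * i)\<close> forces a wrong 1 at \<open>2 * i + 1\<close>.\<close>
  define e where "e i = (if h (real (2 * i)) then 2 * i + 1 else 2 * i)" for i
  have e_div: "e i div 2 = i" for i by (auto simp: e_def)
  have inj: "inj_on e A" for A by (rule inj_on_inverseI[where g = "\<lambda>p. p div 2"]) (rule e_div)
  have e_bad: "?f (real (e i)) \<noteq> h (real (e i))" if "i \<in> {..<N} - ?G" for i
  proof -
    have "\<not> ?f (real (2 * i + 1))"
    proof
      assume "?f (real (2 * i + 1))"
      then obtain l where "real (2 * i + 1) = real (2 * l)" unfolding pair_label_def by blast
      then have "2 * i + 1 = 2 * l" by (simp only: of_nat_eq_iff)
      then have "even (2 * i + 1) = even (2 * l)" by (rule arg_cong)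
      then show False by simp
    qed
    then show ?thesis using that by (auto simp: e_def pair_label_def)
  qed
  have "{x. ?f x \<noteq> h x} \<in> sets borel"
  proof -
    have [measurable]: "h \<in> borel \<rightarrow>\<^sub>M count_space UNIV" "?f \<in> borel \<rightarrow>\<^sub>M count_space UNIV"
      using interval_union_measurable h pair_label_interval_union[of "{..<N}" N] by auto
    show ?thesis by measurable
  qed
  then have "measure (pair_dist N y) (real ` e ` ({..<N} - ?G)) \<le> fun_dist (pair_dist N y) ?f h"
    unfolding fun_dist_def using e_bad by (intro finite_measure_mono) auto
  moreover have "measure (pair_dist N y) (real ` e ` ({..<N} - ?G)) = (\<Sum>i\<in>{..<N} - ?G. pair_mass N y (e i))"
  proof -
    have "e ` ({..<N} - ?G) \<subseteq> {..2 * N}" by (auto simp: e_def)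
    from measure_pair_dist[OF y this] show ?thesis by (simp only: sum.reindex[OF inj] o_def)
  qed
  moreover have "(\<Sum>i\<in>{..<N} - ?G. pair_mass N y (e i)) \<ge> (\<Sum>i\<in>{..<N} - ?G. \<delta> / 2)"
  proof (rule sum_mono)
    fix i assume i: "i \<in> {..<N} - ?G"
    then have "e i < 2 * N" by (auto simp: e_def)
    then show "pair_mass N y (e i) \<ge> \<delta> / 2" using \<delta>(2)[of i] i by (simp add: pair_mass_def e_div)
  qed
  moreover have "(\<Sum>i\<in>{..<N} - ?G. \<delta> / 2) \<ge> (real N - real k) * \<delta> / 2"
  proof -
    have "card ({..<N} - ?G) = N - card ?G" by (subst card_Diff_subset) auto
    then have "real (card ({..<N} - ?G)) \<ge> real N - real k"
      using interval_union_card_drops[OF h, of N] by linarith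
    then show ?thesis using \<delta>(1) by (simp add: mult_right_mono divide_right_mono)
  qed
  ultimately show "(real N - real k) * \<delta> / 2 \<le> fun_dist (pair_dist N y) ?f h" by linarith
qed

section \<open>Runs of a tester on the pair distribution\<close>

locale pair_experiment = R: prob_space R for R :: "real measure" +
  fixes N t :: nat and y :: "nat \<Rightarrow> real"
  assumes nonneg: "\<And>i. i < N \<Longrightarrow> y i \<ge> 0" and sum_le_1: "(\<Sum>i<N. y i) \<le> 1"
begin

sublocale D: prob_space "pair_dist N y"
  by (rule prob_space_pair_dist[OF nonneg sum_le_1])

sublocale DP: finite_product_prob_space "\<lambda>_. pair_dist N y" "{..<t}"
  by unfold_locales auto

sublocale P: pair_prob_space R "Pi\<^sub>M {..<t} (\<lambda>_. pair_dist N y)" ..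

sublocale M: prob_space "run_space R (pair_dist N y) t"
  unfolding run_space_def by (rule P.prob_space_axioms)

text \<open>Almost surely the samples form one of finitely many sequences, and on each of them the
  product measure splits into a seed probability and the probability of the sequence. The sequences
  are restricted to \<open>{..<t}\<close> because points of the product space are
  extensional.\<close>

lemma measure_run_space_pair_dist:
  assumes E: "{(\<omega>, xs) \<in> space (run_space R (pair_dist N y) t). V \<omega> xs} \<in> sets (run_space R (pair_dist N y) t)"
  shows "measure (run_space R (pair_dist N y) t) {(\<omega>, xs) \<in> space (run_space R (pair_dist N y) t). V \<omega> xs} =
     accept t (\<lambda>s. measure R {\<omega> \<in> space R. V \<omega> (\<lambda>r\<in>{..<t}. real (s r))}) N y"
proof -
  let ?D = "pair_dist N y" and ?S = "PiE {..<t} (\<lambda>_. {..2 * N})"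
  let ?M = "run_space R ?D t" and ?P = "Pi\<^sub>M {..<t} (\<lambda>_. ?D)"
  let ?E = "{(\<omega>, xs) \<in> space ?M. V \<omega> xs}"
  let ?e = "\<lambda>s. \<lambda>r\<in>{..<t}. real (s r)"
  have sf: "sigma_finite_measure ?P"
    by (intro prob_space_imp_sigma_finite prob_space_PiM D.prob_space_axioms)
  have space_P: "space ?P = PiE {..<t} (\<lambda>_. UNIV)" by (simp add: space_PiM)
  have e_space: "?e s \<in> space ?P" for s by (simp add: space_P)
  have mP: "measure ?P {?e s} = (\<Prod>r<t. pair_mass N y (s r))" and sP: "{?e s} \<in> sets ?P" if "s \<in> ?S" for s
  proof -
    have "PiE {..<t} (\<lambda>r. {?e s r}) = {?e s}" by (intro PiE_singleton restrict_extensional)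
    moreover have "PiE {..<t} (\<lambda>r. {?e s r}) = PiE {..<t} (\<lambda>r. {real (s r)})" by (intro PiE_cong) simp
    ultimately have eq: "{?e s} = PiE {..<t} (\<lambda>r. {real (s r)})" by simp
    show "{?e s} \<in> sets ?P" unfolding eq by (rule sets_PiM_I_finite) auto
    have "measure ?P {?e s} = (\<Prod>r<t. measure ?D {real (s r)})"
      unfolding eq by (rule DP.finite_measure_PiM_emb) auto
    also have "\<dots> = (\<Prod>r<t. pair_mass N y (s r))"
    proof (intro prod.cong refl)
      fix r assume "r \<in> {..<t}"
      then have "s r \<le> 2 * N" using that by (auto dest: PiE_mem)
      then show "measure ?D {real (s r)} = pair_mass N y (s r)"
        using measure_pair_dist[OF nonneg sum_le_1, of "{s r}"] by simp
    qed
    finally show "measure ?P {?e s} = (\<Prod>r<t. pair_mass N y (s r))" .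
  qed
  have inj: "inj_on ?e ?S"
  proof (rule inj_onI)
    fix s s' assume s: "s \<in> ?S" "s' \<in> ?S" "?e s = ?e s'"
    have "s r = s' r" if "r < t" for r using fun_cong[OF s(3), of r] that by simp
    then show "s = s'" using s(1,2) by (intro PiE_ext) auto
  qed
  have mM: "measure ?M (A \<times> {?e s}) = measure R A * (\<Prod>r<t. pair_mass N y (s r))"
    and sM: "A \<times> {?e s} \<in> sets ?M" if "A \<in> sets R" "s \<in> ?S" for A s
  proof -
    show "A \<times> {?e s} \<in> sets ?M" unfolding run_space_def using that sP by (intro pair_measureI) auto
    show "measure ?M (A \<times> {?e s}) = measure R A * (\<Prod>r<t. pair_mass N y (s r))"
      unfolding run_space_def Sigma_Algebra.measure_def mP[OF that(2), symmetric]
      using that sP[OF that(2)] by (subst sigma_finite_measure.emeasure_pair_measure_Times[OF sf]) (auto simp: enn2real_mult)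
  qed
  \<comment> \<open>One slice per sample sequence. The slices are disjoint and their measures add up
    to 1, so the event may be cut down to them.\<close>
  define B where "B s = space R \<times> {?e s}" for s
  have B: "B s \<in> sets ?M" if "s \<in> ?S" for s unfolding B_def by (rule sM) (use that in auto)
  have disj: "disjoint_family_on B ?S"
    unfolding disjoint_family_on_def B_def using inj by (auto dest: inj_onD)
  have fin: "finite ?S" by (intro finite_PiE) auto
  have "measure ?M (\<Union>s\<in>?S. B s) = (\<Sum>s\<in>?S. measure ?M (B s))"
    using M.finite_measure_finite_Union[OF fin _ disj] B by auto
  also have "\<dots> = (\<Sum>s\<in>?S. \<Prod>r<t. pair_mass N y (s r))"
    unfolding B_def by (intro sum.cong refl, subst mM) (auto simp: R.prob_space)
  also have "\<dots> = (\<Prod>r<t. \<Sum>p\<le>2 * N. pair_mass N y p)" by (subst prod_sum_PiE) auto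
  also have "\<dots> = 1" by (simp add: sum_pair_mass)
  finally have full: "measure ?M (\<Union>s\<in>?S. B s) = 1" .
  have UB: "(\<Union>s\<in>?S. B s) \<in> sets ?M" using fin B by (intro sets.finite_UN) auto
  have "measure ?M (?E - (\<Union>s\<in>?S. B s)) \<le> measure ?M (space ?M - (\<Union>s\<in>?S. B s))"
    using E UB by (intro M.finite_measure_mono) auto
  also have "\<dots> = 0" using M.prob_compl[OF UB] full by simp
  finally have "measure ?M (?E - (\<Union>s\<in>?S. B s)) = 0" by (simp add: measure_le_0_iff)
  then have "measure ?M ?E = measure ?M (\<Union>s\<in>?S. ?E \<inter> B s)"
    using M.finite_measure_Diff'[OF E UB] by (simp only: Int_UN_distrib)
  also have "\<dots> = (\<Sum>s\<in>?S. measure ?M (?E \<inter> B s))"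
  proof (rule M.finite_measure_finite_Union[OF fin])
    show "disjoint_family_on (\<lambda>s. ?E \<inter> B s) ?S"
      using disj unfolding disjoint_family_on_def by blast
  qed (use E B in auto)
  also have "\<dots> = (\<Sum>s\<in>?S. measure R {\<omega> \<in> space R. V \<omega> (?e s)} * (\<Prod>r<t. pair_mass N y (s r)))"
  proof (intro sum.cong refl)
    fix s assume s: "s \<in> ?S"
    have eq: "?E \<inter> B s = {\<omega> \<in> space R. V \<omega> (?e s)} \<times> {?e s}"
      using e_space[of s] by (auto simp: B_def run_space_def space_pair_measure)
    have "(\<lambda>\<omega>. (\<omega>, ?e s)) -` ?E \<inter> space R \<in> sets R"
      using E unfolding run_space_def by (intro measurable_sets[OF measurable_Pair2'[OF e_space]]) 
    moreover have "(\<lambda>\<omega>. (\<omega>, ?e s)) -` ?E \<inter> space R = {\<omega> \<in> space R. V \<omega> (?e s)}"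
      using e_space[of s] by (auto simp: run_space_def space_pair_measure)
    ultimately have "{\<omega> \<in> space R. V \<omega> (?e s)} \<in> sets R" by simp
    then show "measure ?M (?E \<inter> B s) = measure R {\<omega> \<in> space R. V \<omega> (?e s)} * (\<Prod>r<t. pair_mass N y (s r))"
      unfolding eq by (rule mM[OF _ s])
  qed
  finally show ?thesis unfolding accept_def .
qed

text \<open>Positive measure already forces the event to be measurable, since \<open>measure\<close>
  vanishes on non-measurable sets.\<close>

lemma accept_ge:
  assumes *: "measure (run_space R (pair_dist N y) t) {(\<omega>, xs) \<in> space (run_space R (pair_dist N y) t). V \<omega> xs} \<ge> 2 / 3"
  shows "accept t (\<lambda>s. measure R {\<omega> \<in> space R. V \<omega> (\<lambda>r\<in>{..<t}. real (s r))}) N y \<ge> 2 / 3"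
proof -
  have "{(\<omega>, xs) \<in> space (run_space R (pair_dist N y) t). V \<omega> xs} \<in> sets (run_space R (pair_dist N y) t)"
  proof (rule ccontr)
    assume "{(\<omega>, xs) \<in> space (run_space R (pair_dist N y) t). V \<omega> xs} \<notin> sets (run_space R (pair_dist N y) t)"
    from measure_notin_sets[OF this] * show False by simp
  qed
  from measure_run_space_pair_dist[OF this] * show ?thesis by simp
qed

lemma accept_le:
  assumes *: "measure (run_space R (pair_dist N y) t) {(\<omega>, xs) \<in> space (run_space R (pair_dist N y) t). \<not> V \<omega> xs} \<ge> 2 / 3"
  shows "accept t (\<lambda>s. measure R {\<omega> \<in> space R. V \<omega> (\<lambda>r\<in>{..<t}. real (s r))}) N y \<le> 1 / 3"
proof -
  let ?M = "run_space R (pair_dist N y) t"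
  let ?F = "{(\<omega>, xs) \<in> space ?M. \<not> V \<omega> xs}" and ?E = "{(\<omega>, xs) \<in> space ?M. V \<omega> xs}"
  have F: "?F \<in> sets ?M"
  proof (rule ccontr)
    assume "?F \<notin> sets ?M"
    from measure_notin_sets[OF this] * show False by simp
  qed
  have eq: "?E = space ?M - ?F" by auto
  have E: "?E \<in> sets ?M" unfolding eq using F by auto
  have "measure ?M ?E \<le> 1 / 3" unfolding eq using M.prob_compl[OF F] * by simp
  with measure_run_space_pair_dist[OF E] show ?thesis by simp
qed

end

text \<open>The support size problem to which both kinds of tester reduce. A single
  \<open>acc\<close> must serve all \<open>y\<close>, as the labelling does not depend on the
  masses; \<open>(N - k) * \<delta> / 2\<close> is the lower bound for the distance.\<close>

definition distinguishes :: "real \<Rightarrow> nat \<Rightarrow> nat \<Rightarrow> ((nat \<Rightarrow> nat) \<Rightarrow> real) \<Rightarrow> nat \<Rightarrow> bool" where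
  "distinguishes \<epsilon> k t acc N \<longleftrightarrow> (\<forall>s. 0 \<le> acc s \<and> acc s \<le> 1) \<and>
     (\<forall>y. (\<forall>i<N. y i \<ge> 0) \<longrightarrow> (\<Sum>i<N. y i) \<le> 1 \<longrightarrow>
        (card {i. i < N \<and> y i > 0} \<le> k \<longrightarrow> accept t acc N y \<ge> 2 / 3) \<and>
        (\<forall>\<delta>\<ge>0. (\<forall>i<N. y i \<ge> \<delta>) \<longrightarrow> (real N - real k) * \<delta> / 2 \<ge> \<epsilon> \<longrightarrow> accept t acc N y \<le> 1 / 3))"

text \<open>
  A sample tester is only guaranteed to accept functions in the class, so in the first case it is run on the
  labelling restricted to the support, which yields the same labelled samples almost surely.
\<close>

lemma sample_tester_distinguishes:
  assumes T: "sample_tester \<epsilon> (interval_unions k) t R T"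
  shows "\<exists>acc. distinguishes \<epsilon> k t acc N"
proof -
  define V where "V f \<omega> xs = T \<omega> (labelled f t xs)" for f :: "real \<Rightarrow> bool" and \<omega> xs
  define acc where "acc f s = measure R {\<omega> \<in> space R. V f \<omega> (\<lambda>r\<in>{..<t}. real (s r))}" for f and s :: "nat \<Rightarrow> nat"
  have R: "prob_space R" using T unfolding sample_tester_def by blast
  interpret R: prob_space R by fact
  have pair_exp: "pair_experiment R N y" if "\<forall>i<N. y i \<ge> 0" "(\<Sum>i<N. y i) \<le> 1" for y
    using that by (intro pair_experiment.intro R pair_experiment_axioms.intro) auto
  have "distinguishes \<epsilon> k t (acc (pair_label {..<N})) N"
    unfolding distinguishes_def
  proof (intro conjI allI impI)
    fix y :: "nat \<Rightarrow> real" assume y: "\<forall>i<N. y i \<ge> 0" "(\<Sum>i<N. y i) \<le> 1" "card {i. i < N \<and> y i > 0} \<le> k"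
    let ?S = "{i. i < N \<and> y i > 0}"
    have "pair_label ?S \<in> interval_unions k" using y by (intro pair_label_interval_union) auto
    moreover have "instance_pair (pair_dist N y) (pair_label ?S)"
      using y by (intro instance_pair_pair_dist) auto
    ultimately have "measure (run_space R (pair_dist N y) t)
        {(\<omega>, xs) \<in> space (run_space R (pair_dist N y) t). V (pair_label ?S) \<omega> xs} \<ge> 2 / 3"
      using T unfolding sample_tester_def V_def by blast
    then have "accept t (acc (pair_label ?S)) N y \<ge> 2 / 3"
      unfolding acc_def using y by (intro pair_experiment.accept_ge pair_exp) auto
    also have "accept t (acc (pair_label ?S)) N y = accept t (acc (pair_label {..<N})) N y"
      unfolding accept_def
    proof (intro sum.cong refl)
      fix s assume s: "s \<in> PiE {..<t} (\<lambda>_. {..2 * N})"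
      show "acc (pair_label ?S) s * (\<Prod>r<t. pair_mass N y (s r)) =
         acc (pair_label {..<N}) s * (\<Prod>r<t. pair_mass N y (s r))"
      proof (cases "\<exists>r<t. pair_mass N y (s r) = 0")
        case True
        then have "(\<Prod>r<t. pair_mass N y (s r)) = 0" by auto
        then show ?thesis by simp
      next
        case False
        have "pair_label ?S (real (s r)) = pair_label {..<N} (real (s r))" if r: "r < t" for r
        proof -
          have "y i > 0" if "i < N" "real (s r) = real (2 * i)" for i
          proof -
            have "s r = 2 * i" using that(2) by (simp only: of_nat_eq_iff)
            then have "pair_mass N y (s r) = y i / 2" using that(1) by (simp add: pair_mass_def)
            then have "y i \<noteq> 0" using False r by auto
            then show ?thesis using y(1) that(1) by (simp add: order.strict_iff_order)
          qed
          then show ?thesis unfolding pair_label_def by auto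
        qed
        then have "labelled (pair_label ?S) t (\<lambda>r\<in>{..<t}. real (s r)) =
            labelled (pair_label {..<N}) t (\<lambda>r\<in>{..<t}. real (s r))"
          unfolding labelled_def by (intro map_cong) auto
        then show ?thesis unfolding acc_def V_def by simp
      qed
    qed
    finally show "accept t (acc (pair_label {..<N})) N y \<ge> 2 / 3" .
  next
    fix y :: "nat \<Rightarrow> real" and \<delta> :: real
    assume y: "\<forall>i<N. y i \<ge> 0" "(\<Sum>i<N. y i) \<le> 1" and \<delta>: "0 \<le> \<delta>" "\<forall>i<N. y i \<ge> \<delta>" "(real N - real k) * \<delta> / 2 \<ge> \<epsilon>"
    have "class_dist (pair_dist N y) (pair_label {..<N}) (interval_unions k) \<ge> (real N - real k) * \<delta> / 2"
      using y \<delta> by (intro class_dist_pair_label_ge) auto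
    then have "class_dist (pair_dist N y) (pair_label {..<N}) (interval_unions k) \<ge> \<epsilon>" using \<delta>(3) by linarith
    moreover have "instance_pair (pair_dist N y) (pair_label {..<N})"
      using y by (intro instance_pair_pair_dist) auto
    ultimately have "measure (run_space R (pair_dist N y) t)
        {(\<omega>, xs) \<in> space (run_space R (pair_dist N y) t). \<not> V (pair_label {..<N}) \<omega> xs} \<ge> 2 / 3"
      using T unfolding sample_tester_def V_def by blast
    then show "accept t (acc (pair_label {..<N})) N y \<le> 1 / 3"
      unfolding acc_def using y by (intro pair_experiment.accept_le pair_exp) auto
  qed (simp_all add: acc_def)
  then show ?thesis by blast
qed

text \<open>With the labelling fixed, the answers to queries are known in advance and a run depends
  only on seed and samples. Acceptance is guaranteed at distance 0, so the full labelling works in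
  both cases.\<close>

lemma query_tester_distinguishes:
  assumes T: "query_tester \<epsilon> (interval_unions k) t R A"
  shows "\<exists>acc. distinguishes \<epsilon> k t acc N"
proof -
  define V where "V \<omega> xs = run (pair_label {..<N}) xs (A \<omega>) 0" for \<omega> xs
  define acc where "acc s = measure R {\<omega> \<in> space R. V \<omega> (\<lambda>r\<in>{..<t}. real (s r))}" for s :: "nat \<Rightarrow> nat"
  have R: "prob_space R" using T unfolding query_tester_def by blast
  interpret R: prob_space R by fact
  have pair_exp: "pair_experiment R N y" if "\<forall>i<N. y i \<ge> 0" "(\<Sum>i<N. y i) \<le> 1" for y
    using that by (intro pair_experiment.intro R pair_experiment_axioms.intro) auto
  have "distinguishes \<epsilon> k t acc N"
    unfolding distinguishes_def
  proof (intro conjI allI impI)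
    fix y :: "nat \<Rightarrow> real" assume y: "\<forall>i<N. y i \<ge> 0" "(\<Sum>i<N. y i) \<le> 1" "card {i. i < N \<and> y i > 0} \<le> k"
    have "class_dist (pair_dist N y) (pair_label {..<N}) (interval_unions k) = 0"
      using y by (intro class_dist_pair_label_eq_0) auto
    moreover have "instance_pair (pair_dist N y) (pair_label {..<N})"
      using y by (intro instance_pair_pair_dist) auto
    ultimately have "measure (run_space R (pair_dist N y) t)
        {(\<omega>, xs) \<in> space (run_space R (pair_dist N y) t). V \<omega> xs} \<ge> 2 / 3"
      using T unfolding query_tester_def V_def by blast
    then show "accept t acc N y \<ge> 2 / 3"
      unfolding acc_def using y by (intro pair_experiment.accept_ge pair_exp) auto
  next
    fix y :: "nat \<Rightarrow> real" and \<delta> :: real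
    assume y: "\<forall>i<N. y i \<ge> 0" "(\<Sum>i<N. y i) \<le> 1" and \<delta>: "0 \<le> \<delta>" "\<forall>i<N. y i \<ge> \<delta>" "(real N - real k) * \<delta> / 2 \<ge> \<epsilon>"
    have "class_dist (pair_dist N y) (pair_label {..<N}) (interval_unions k) \<ge> (real N - real k) * \<delta> / 2"
      using y \<delta> by (intro class_dist_pair_label_ge) auto
    then have "class_dist (pair_dist N y) (pair_label {..<N}) (interval_unions k) \<ge> \<epsilon>" using \<delta>(3) by linarith
    moreover have "instance_pair (pair_dist N y) (pair_label {..<N})"
      using y by (intro instance_pair_pair_dist) auto
    ultimately have "measure (run_space R (pair_dist N y) t)
        {(\<omega>, xs) \<in> space (run_space R (pair_dist N y) t). \<not> V \<omega> xs} \<ge> 2 / 3"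
      using T unfolding query_tester_def V_def by blast
    then show "accept t acc N y \<le> 1 / 3"
      unfolding acc_def using y by (intro pair_experiment.accept_le pair_exp) auto
  qed (simp_all add: acc_def)
  then show ?thesis by blast
qed

subsection \<open>The lower bound\<close>

text \<open>The inequality that fails asymptotically when \<open>m\<close> is about
  \<open>ln x\<close>: the left side tends to 0, the right side to 1/3, and 1/6 separates
  them.\<close>

lemma eventually_gap_positive:
  assumes "(\<gamma>::real) < 0"
  shows "\<forall>\<^sub>F x :: real in at_top. x * (2 * exp (- 2 * ln x) + 2 * exp (1 - 16 * x / (ln x + 1)\<^sup>2)) <
     2 / 3 * (1 - exp (1 - 16 * x / (ln x + 1)\<^sup>2) - exp (x * \<gamma>)) - 1 / 3"
proof -
  have 1: "((\<lambda>x::real. x * (2 * exp (- 2 * ln x) + 2 * exp (1 - 16 * x / (ln x + 1)\<^sup>2))) \<longlongrightarrow> 0) at_top"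
    by real_asymp
  have 2: "((\<lambda>x::real. exp (1 - 16 * x / (ln x + 1)\<^sup>2)) \<longlongrightarrow> 0) at_top"
    by real_asymp
  have 3: "((\<lambda>x::real. exp (x * \<gamma>)) \<longlongrightarrow> 0) at_top"
    using assms by real_asymp
  have "((\<lambda>x. 2 / 3 * (1 - exp (1 - 16 * x / (ln x + 1)\<^sup>2) - exp (x * \<gamma>)) - 1 / 3) \<longlongrightarrow>
      2 / 3 * (1 - 0 - 0) - 1 / 3) at_top"
    by (intro tendsto_intros 2 3)
  then have "\<forall>\<^sub>F x in at_top.
      1 / 6 < 2 / 3 * (1 - exp (1 - 16 * x / (ln x + 1)\<^sup>2) - exp (x * \<gamma>)) - 1 / 3"
    by (rule order_tendstoD(1)) simp
  moreover have "\<forall>\<^sub>F x :: real in at_top.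
      x * (2 * exp (- 2 * ln x) + 2 * exp (1 - 16 * x / (ln x + 1)\<^sup>2)) < 1 / 6"
    using 1 by (rule order_tendstoD(2)) simp
  ultimately show ?thesis by eventually_elim (rule less_trans)
qed

text \<open>Without samples \<open>accept\<close> ignores \<open>y\<close>, yet zero masses demand
  acceptance and uniform masses on \<open>2 * k\<close> elements, at distance at least 1/4, demand
  rejection. This settles small \<open>k\<close>.\<close>

lemma not_distinguishes_0:
  assumes "k > 0" "\<epsilon> \<le> 1 / 4"
  shows "\<not> distinguishes \<epsilon> k 0 acc (2 * k)"
proof
  assume "distinguishes \<epsilon> k 0 acc (2 * k)"
  then have d: "(\<forall>i<2*k. y i \<ge> 0) \<Longrightarrow> (\<Sum>i<2*k. y i) \<le> 1 \<Longrightarrow>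
        (card {i. i < 2*k \<and> y i > 0} \<le> k \<longrightarrow> accept 0 acc (2*k) y \<ge> 2 / 3) \<and>
        (\<forall>\<delta>\<ge>0. (\<forall>i<2*k. y i \<ge> \<delta>) \<longrightarrow> (real (2*k) - real k) * \<delta> / 2 \<ge> \<epsilon> \<longrightarrow> accept 0 acc (2*k) y \<le> 1 / 3)" for y
    unfolding distinguishes_def by blast
  have "accept 0 acc (2*k) (\<lambda>_. 0) \<ge> 2 / 3" using d[of "\<lambda>_. 0"] by simp
  moreover have "accept 0 acc (2*k) (\<lambda>_. 1 / (2 * real k)) \<le> 1 / 3"
    using d[of "\<lambda>_. 1 / (2 * real k)"] assms by (auto dest!: spec[of _ "1 / (2 * real k)"])
  moreover have "accept 0 acc (2*k) (\<lambda>_. 0) = accept 0 acc (2*k) (\<lambda>_. 1 / (2 * real k))"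
    by (simp add: accept_def)
  ultimately show False by simp
qed

text \<open>Take \<open>N\<close> about \<open>9/8 * k\<close> and \<open>m\<close> about
  \<open>ln N\<close>. A smaller \<open>t\<close> would satisfy \<open>t * m \<le> 2 * N\<close>,
  and the gap inequality would contradict its asymptotics.\<close>

lemma distinguishes_large:
  "\<exists>K. \<forall>k\<ge>K. \<forall>t. (\<forall>N. \<exists>acc. distinguishes (1 / 18432) k t acc N) \<longrightarrow> real t \<ge> 1 / 2 * (real k / ln (real k))"
proof -
  define \<gamma> :: real where "\<gamma> = ln (7/4) - 7/8 * ln 2"
  \<comment> \<open>This amounts to 7^8 < 2^23.\<close>
  have "\<gamma> < 0"
  proof -
    have "8 * ln (7/4::real) = ln ((7/4) ^ 8)" by (simp add: ln_realpow)
    also have "\<dots> < ln (2 ^ 7)" by (subst ln_less_cancel_iff) (auto simp: power_divide)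
    also have "\<dots> = real 7 * ln (2::real)" by (rule ln_realpow)
    finally show ?thesis by (simp add: \<gamma>_def)
  qed
  from eventually_gap_positive[OF this] obtain x0 where
    x0: "\<And>x. x \<ge> x0 \<Longrightarrow> x * (2 * exp (- 2 * ln x) + 2 * exp (1 - 16 * x / (ln x + 1)\<^sup>2)) <
     2 / 3 * (1 - exp (1 - 16 * x / (ln x + 1)\<^sup>2) - exp (x * \<gamma>)) - 1 / 3"
    unfolding eventually_at_top_linorder by blast
  \<comment> \<open>The bound 8 ensures \<open>k div 8 \<ge> 1\<close>, hence
    \<open>N > k\<close>.\<close>
  define K where "K = max 8 (nat \<lceil>x0\<rceil>)"
  have "real t \<ge> 1 / 2 * (real k / ln (real k))"
    if k: "k \<ge> K" and D: "\<forall>N. \<exists>acc. distinguishes (1 / 18432) k t acc N" for k t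
  proof (rule ccontr)
    assume contr: "\<not> real t \<ge> 1 / 2 * (real k / ln (real k))"
    define N where "N = k + k div 8"
    define m where "m = nat \<lceil>ln (real N)\<rceil>"
    define q r where "q = k div 8" and "r = k mod 8"
    have k8: "k \<ge> 8" and kx: "real k \<ge> x0" using k unfolding K_def by linarith+
    have qr: "k = 8 * q + r" "r < 8" unfolding q_def r_def by simp_all
    then have "q \<ge> 1" using k8 by linarith
    then have q: "8 * q \<le> k" "k \<le> 17 * q" using qr by linarith+
    have N_eq: "N = k + q" by (simp add: N_def q_def)
    have N: "N > 0" "N \<ge> k" "N \<le> 2 * k" using k8 q unfolding N_eq by linarith+
    have ln_N: "ln (real N) > 0" using N k8 by simp
    have m: "m > 0" "ln (real N) \<le> real m" "real m \<le> ln (real N) + 1"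
      unfolding m_def using ln_N by linarith+
    have ln_k: "ln (real k) > 0" "ln 2 \<le> ln (real k)" using k8 by auto
    have "ln (real N) \<le> ln (2 * real k)" using N k8 by simp
    also have "\<dots> = ln 2 + ln (real k)" using k8 by (simp add: ln_mult)
    also have "\<dots> \<le> 2 * ln (real k)" using ln_k by simp
    finally have "real m \<le> 2 * ln (real k) + 1" using m by simp
    moreover have "1 \<le> 2 * ln (real k)" using ln_k ln2_ge_two_thirds by linarith
    ultimately have "real m \<le> 4 * ln (real k)" by simp
    moreover have "real t \<le> 1 / 2 * (real k / ln (real k))" using contr by simp
    ultimately have "real t * real m \<le> 1 / 2 * (real k / ln (real k)) * (4 * ln (real k))"
      using ln_k by (intro mult_mono) auto
    also have "\<dots> = 2 * real k" using ln_k by simp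
    finally have "real (t * m) \<le> real (2 * N)" using N by simp
    then have tm: "t * m \<le> 2 * N" by (simp only: of_nat_le_iff)
    obtain acc where acc: "distinguishes (1 / 18432) k t acc N" using D by blast
    \<comment> \<open>The gap inequality is monotone in both exponentials, so \<open>m\<close> may
      be replaced by its bounds \<open>ln N \<le> m \<le> ln N + 1\<close>.\<close>
    have combine: False
      if "2 / 3 * (1 - b - g) - 1 / 3 \<le> n * (2 * a + 2 * b)" "a \<le> a'" "b \<le> b'" "n \<ge> 0"
        "n * (2 * a' + 2 * b') < 2 / 3 * (1 - b' - g) - 1 / 3" for a a' b b' g n :: real
    proof -
      have "n * (2 * a' + 2 * b') < 2 / 3 * (1 - b' - g) - 1 / 3" by fact
      also have "\<dots> \<le> 2 / 3 * (1 - b - g) - 1 / 3" using that(3) by simp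
      also have "\<dots> \<le> n * (2 * a + 2 * b)" by fact
      also have "\<dots> \<le> n * (2 * a' + 2 * b')" using that by (intro mult_left_mono) auto
      finally show False by simp
    qed
    have "2 / 3 * (1 - exp (1 - 16 * real N / (real m)\<^sup>2) - exp (real N * (ln (7/4) - 7/8 * ln 2))) - 1 / 3
       \<le> real N * (2 * exp (- 2 * real m) + 2 * exp (1 - 16 * real N / (real m)\<^sup>2))"
    proof (rule pair_sample_lower_bound[OF m(1) N(1) _ tm])
      have "8 * N \<le> 9 * k" using q(1) unfolding N_eq by simp
      then show "7 / 8 * real N \<le> real k" by linarith
    next
      fix y :: "nat \<Rightarrow> real"
      assume y: "\<And>i. i < N \<Longrightarrow> 1 / (512 * real N) \<le> y i" "(\<Sum>i<N. y i) \<le> 1"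
      have "N \<le> 18 * q" using q(2) unfolding N_eq by simp
      then have "real N \<le> real (18 * q)" by (rule of_nat_mono)
      also have "\<dots> = 18 * (real N - real k)" by (simp add: N_eq)
      finally have "real N \<le> 18 * (real N - real k)" .
      \<comment> \<open>Here 18432 = 18 * 512 * 2: at least N/18 erroneous pairs, each with an error
        of half the mass \<open>1 / (512 * N)\<close>.\<close>
      then have "(real N - real k) * (1 / (512 * real N)) / 2 \<ge> 1 / 18432"
        using N by (simp add: field_simps)
      moreover have "0 \<le> y i" if "i < N" for i
        by (rule order.trans[OF _ y(1)[OF that]]) simp
      moreover have "0 \<le> 1 / (512 * real N)" by simp
      ultimately show "accept t acc N y \<le> 1 / 3"
        using acc y unfolding distinguishes_def by blast
    next
      show "0 \<le> acc s \<and> acc s \<le> 1" for s using acc unfolding distinguishes_def by blast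
    next
      fix y :: "nat \<Rightarrow> real"
      assume "\<And>i. i < N \<Longrightarrow> 0 \<le> y i" "(\<Sum>i<N. y i) \<le> 1" "card {i. i < N \<and> 0 < y i} \<le> k"
      then show "2 / 3 \<le> accept t acc N y" using acc unfolding distinguishes_def by blast
    qed
    moreover have "exp (- 2 * real m) \<le> exp (- 2 * ln (real N))" using m by simp
    moreover have "exp (1 - 16 * real N / (real m)\<^sup>2) \<le> exp (1 - 16 * real N / (ln (real N) + 1)\<^sup>2)"
    proof -
      have pos: "0 < real m" "0 < ln (real N) + 1" using m(1) ln_N by linarith+
      then have "(real m)\<^sup>2 \<le> (ln (real N) + 1)\<^sup>2" using m(3) by (intro power_mono) auto
      then have "16 * real N / (ln (real N) + 1)\<^sup>2 \<le> 16 * real N / (real m)\<^sup>2"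
        by (rule divide_left_mono) (use pos in \<open>auto intro: mult_pos_pos zero_less_power\<close>)
      then show ?thesis by (simp only: exp_le_cancel_iff diff_left_mono)
    qed
    moreover have "real N \<ge> 0" by simp
    moreover have "real N \<ge> x0" using kx N by simp
    note x0[OF this, unfolded \<gamma>_def]
    ultimately show False by (rule combine)
  qed
  then show ?thesis by blast
qed

text \<open>The infimum is attained unless the set is empty, and then it is infinite.\<close>

lemma ereal_le_Inf_enat:
  assumes "\<And>n. P n \<Longrightarrow> x \<le> real n"
  shows "ereal x \<le> ereal_of_enat (Inf {enat n | n. P n})"
proof (cases "{enat n | n. P n} = {}")
  case False
  then obtain z where "z \<in> {enat n | n. P n}" by blast
  then have "Inf {enat n | n. P n} \<in> {enat n | n. P n}" by (rule wellorder_InfI)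
  then show ?thesis using assms by auto
qed (simp add: Inf_enat_def)

theorem theorem3p2:
  "\<exists>\<epsilon>::real. \<epsilon> > 0 \<and> (\<exists>c::real. c > 0 \<and>
     (\<forall>k::nat. k \<ge> 2 \<longrightarrow>
        ereal_of_enat (m_test \<epsilon> (interval_unions k)) \<ge> ereal (c * (real k / ln (real k))) \<and>
        ereal_of_enat (q_test \<epsilon> (interval_unions k)) \<ge> ereal (c * (real k / ln (real k)))))"
proof -
  have m_test: "ereal x \<le> ereal_of_enat (m_test (1 / 18432) (interval_unions k))"
    if "\<And>t. (\<And>N. \<exists>acc. distinguishes (1 / 18432) k t acc N) \<Longrightarrow> x \<le> real t" for x k
    unfolding m_test_def
    by (rule ereal_le_Inf_enat) (use that sample_tester_distinguishes in blast)
  have q_test: "ereal x \<le> ereal_of_enat (q_test (1 / 18432) (interval_unions k))"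
    if "\<And>t. (\<And>N. \<exists>acc. distinguishes (1 / 18432) k t acc N) \<Longrightarrow> x \<le> real t" for x k
    unfolding q_test_def
    by (rule ereal_le_Inf_enat) (use that query_tester_distinguishes in blast)
  obtain K where K: "\<And>k t. k \<ge> K \<Longrightarrow> (\<forall>N. \<exists>acc. distinguishes (1 / 18432) k t acc N) \<Longrightarrow>
      real t \<ge> 1 / 2 * (real k / ln (real k))"
    using distinguishes_large by blast
  \<comment> \<open>The first term serves \<open>k \<ge> K\<close>. The second makes the claimed
    bound at most 1 for \<open>k < K\<close>, where \<open>t \<ge> 1\<close> suffices.\<close>
  define c where "c = min (1 / 2) (ln 2 / (real K + 1))"
  have c: "c > 0" "c \<le> 1 / 2" "c \<le> ln 2 / (real K + 1)"
    unfolding c_def by (simp, rule min.cobounded1, rule min.cobounded2)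
  have bound: "c * (real k / ln (real k)) \<le> real t"
    if k: "k \<ge> 2" and D: "\<And>N. \<exists>acc. distinguishes (1 / 18432) k t acc N" for k t
  proof (cases "k \<ge> K")
    case True
    have "c * (real k / ln (real k)) \<le> 1 / 2 * (real k / ln (real k))"
      using c k by (intro mult_right_mono) auto
    also have "\<dots> \<le> real t" by (rule K[OF True]) (use D in blast)
    finally show ?thesis .
  next
    case False
    have "t \<noteq> 0"
    proof
      assume "t = 0"
      then show False using D[of "2 * k"] not_distinguishes_0[of k "1 / 18432"] k by auto
    qed
    have "c * (real k / ln (real k)) \<le> ln 2 / (real K + 1) * ((real K + 1) / ln 2)"
      using c k False by (intro mult_mono frac_le) auto
    also have "\<dots> = 1" by simp
    also have "1 \<le> real t" using \<open>t \<noteq> 0\<close> by simp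
    finally show ?thesis .
  qed
  show ?thesis
    using c(1) m_test q_test bound by (intro exI[of _ "1 / 18432"] conjI exI[of _ c]) auto
qed

end
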